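(* Let $\ell\in\mathbb{N}^+$, $2\le\eta\in\mathbb{N}^+$ and $\sigma>0$, and assume $F_1,\dots,F_\ell\in\mathcal{G}(\mathbb{T}_\sigma^\infty)$. Then for almost all $(\rho_1,\dots,\rho_\ell)$ with $\rho_j\in\mathbb{T}^\infty$ there is some $\zeta_3>1$ such that, for $N\in\mathbb N^+$ and $T>0$ sufficiently large, $$\Big|\mathrm{DMW}_N^\ell(\mathcal F)(\theta)-\prod_{j=1}^\ell\Big(\int_{\mathbb{T}^\infty}F_j(\hat\theta)\,d\hat\theta\Big)\Big|=\mathcal{O}\big(\exp(-(\log N)^{\zeta_3})\big)$$ and $$\Big|\mathrm{CMW}_T^\ell(\mathcal F)(\theta)-\prod_{j=1}^\ell\Big(\int_{\mathbb{T}^\infty}F_j(\hat\theta)\,d\hat\theta\Big)\Big|=\mathcal{O}\big(\exp(-(\log T)^{\zeta_3})\big).$$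
   Context: Weight: $w(x)=\exp(-x^{-1}(1-x)^{-1})\big(\int_0^1\exp(-t^{-1}(1-t)^{-1})dt\big)^{-1}$ for $x\in(0,1)$ and $w(x)=0$ otherwise. Torus and rotations: $\mathbb{T}^\infty=\mathbb{T}^{\mathbb N}$ (with $0\in\mathbb N$), with the product probability measure; rotation vectors are taken in the cube $[1,2]^{\mathbb N}$ (identified with $\mathbb{T}^\infty$), endowed with the product probability measure, and "almost all $(\rho_1,\dots,\rho_\ell)$" refers to the product probability measure on $([1,2]^{\mathbb N})^\ell$. For $s\ge0$, $\mathscr{T}_\rho^s(\theta)=\theta+s\rho\bmod 1$ in each coordinate. Averages (for $\theta\in\mathbb{T}^\infty$): with $A_N=\sum_{s=0}^{N-1}w(s/N)$, $$\mathrm{DMW}_N^\ell(\mathcal F)(\theta)=\frac1{A_N}\sum_{n=0}^{N-1}w(n/N)F_1(\mathscr{T}_{\rho_1}^n(\theta))\cdots F_\ell(\mathscr{T}_{\rho_\ell}^n(\theta)),$$ $$\mathrm{CMW}_T^\ell(\mathcal F)(\theta)=\frac1T\int_0^T w(s/T)F_1(\mathscr{T}_{\rho_1}^s(\theta))\cdots F_\ell(\mathscr{T}_{\rho_\ell}^s(\theta))\,ds .$$ For $j\in\mathbb N$, $\langle j\rangle=\max\{1,|j|\}$; $\mathbb{Z}_*^\infty=\{k\in\mathbb{Z}^{\mathbb N}:|k|_\eta:=\sum_{j\in\mathbb N}\langle j\rangle^\eta|k_j|<+\infty\}$; $k\cdot\theta=\sum_j k_j\theta_j$. Analytic functions: $\mathbb{T}_\sigma^\infty=\{\theta=(\theta_j)_{j\in\mathbb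 N},\ \theta_j\in\mathbb{C}:\operatorname{Re}\theta_j\in\mathbb{T},\ |\operatorname{Im}\theta_j|\le\sigma\langle j\rangle^\eta\}$, and $\mathcal{G}(\mathbb{T}_\sigma^\infty)$ is the Banach space of functions $u(\theta)=\sum_{k\in\mathbb{Z}_*^\infty}\hat u_ke^{2\pi i k\cdot\theta}$ (scalar coefficients) with $\sum_{k\in\mathbb{Z}_*^\infty}|\hat u_k|e^{2\pi\sigma|k|_\eta}<+\infty$. $\mathcal{O}(\cdot)$ means bounded by a constant, independent of $N$ (resp. $T$), times the argument for all sufficiently large $N$ (resp. $T$). *)

theory Defs
  imports "HOL-Probability.Probability"
begin

definition bump_weight :: "real \<Rightarrow> real" where
  "bump_weight x =
     (if 0 < x \<and> x < 1
      then exp (- (inverse x * inverse (1 - x)))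
           / (LBINT t:{0<..<1}. exp (- (inverse t * inverse (1 - t))))
      else 0)"

text \<open>The circle is represented by the fundamental domain \<open>{0..<1}\<close>, with addition
  followed by \<^const>\<open>frac\<close>. Both measures below live on exactly the stated cube, so that
  values of functions outside it play no role.\<close>

definition torus :: "(nat \<Rightarrow> real) set" where
  "torus = {\<theta>. \<forall>j. \<theta> j \<in> {0..<1}}"

definition torus_measure :: "(nat \<Rightarrow> real) measure" where
  "torus_measure = (\<Pi>\<^sub>M j\<in>UNIV. restrict_space lborel {0..<1})"

definition rotation_measure :: "(nat \<Rightarrow> real) measure" where
  "rotation_measure = (\<Pi>\<^sub>M j\<in>UNIV. restrict_space lborel {1..2})"

definition rotate_by :: "(nat \<Rightarrow> real) \<Rightarrow> real \<Rightarrow> (nat \<Rightarrow> real) \<Rightarrow> (nat \<Rightarrow> real)" where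
  "rotate_by \<rho> s \<theta> = (\<lambda>j. frac (\<theta> j + s * \<rho> j))"

definition jap :: "nat \<Rightarrow> real" where
  "jap j = max 1 (real j)"

definition freqs :: "nat \<Rightarrow> (nat \<Rightarrow> int) set" where
  "freqs \<eta> = {k. summable (\<lambda>j. jap j ^ \<eta> * \<bar>real_of_int (k j)\<bar>)}"

definition freq_norm :: "nat \<Rightarrow> (nat \<Rightarrow> int) \<Rightarrow> real" where
  "freq_norm \<eta> k = (\<Sum>j. jap j ^ \<eta> * \<bar>real_of_int (k j)\<bar>)"

text \<open>For \<open>k \<in> freqs \<eta>\<close> only finitely many \<open>k j\<close> are nonzero, so the series below is a
  finite sum.\<close>

definition freq_dot :: "(nat \<Rightarrow> int) \<Rightarrow> (nat \<Rightarrow> complex) \<Rightarrow> complex" where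
  "freq_dot k \<theta> = (\<Sum>j. of_int (k j) * \<theta> j)"

definition thick_torus :: "nat \<Rightarrow> real \<Rightarrow> (nat \<Rightarrow> complex) set" where
  "thick_torus \<eta> \<sigma> =
     {\<theta>. \<forall>j. Re (\<theta> j) \<in> {0..<1} \<and> \<bar>Im (\<theta> j)\<bar> \<le> \<sigma> * jap j ^ \<eta>}"

text \<open>Membership only constrains the values of \<open>u\<close> on the thickened torus.\<close>

definition analytic_functions :: "nat \<Rightarrow> real \<Rightarrow> ((nat \<Rightarrow> complex) \<Rightarrow> complex) set" where
  "analytic_functions \<eta> \<sigma> =
     {u. \<exists>c :: (nat \<Rightarrow> int) \<Rightarrow> complex.
           (\<lambda>k. norm (c k) * exp (2 * pi * \<sigma> * freq_norm \<eta> k)) summable_on freqs \<eta> \<and>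
           (\<forall>\<theta>\<in>thick_torus \<eta> \<sigma>.
              ((\<lambda>k. c k * exp (2 * of_real pi * \<i> * freq_dot k \<theta>)) has_sum u \<theta>) (freqs \<eta>))}"

definition on_torus :: "((nat \<Rightarrow> complex) \<Rightarrow> complex) \<Rightarrow> (nat \<Rightarrow> real) \<Rightarrow> complex" where
  "on_torus u \<theta> = u (\<lambda>j. complex_of_real (\<theta> j))"

definition orbit_product ::
    "nat \<Rightarrow> (nat \<Rightarrow> (nat \<Rightarrow> complex) \<Rightarrow> complex) \<Rightarrow> (nat \<Rightarrow> nat \<Rightarrow> real) \<Rightarrow> real
      \<Rightarrow> (nat \<Rightarrow> real) \<Rightarrow> complex" where
  "orbit_product l F \<rho> s \<theta> = (\<Prod>i=1..l. on_torus (F i) (rotate_by (\<rho> i) s \<theta>))"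

definition DMW ::
    "nat \<Rightarrow> (nat \<Rightarrow> (nat \<Rightarrow> complex) \<Rightarrow> complex) \<Rightarrow> (nat \<Rightarrow> nat \<Rightarrow> real) \<Rightarrow> nat
      \<Rightarrow> (nat \<Rightarrow> real) \<Rightarrow> complex" where
  "DMW l F \<rho> N \<theta> =
     (\<Sum>n<N. of_real (bump_weight (real n / real N)) * orbit_product l F \<rho> (real n) \<theta>)
     / of_real (\<Sum>s<N. bump_weight (real s / real N))"

definition CMW ::
    "nat \<Rightarrow> (nat \<Rightarrow> (nat \<Rightarrow> complex) \<Rightarrow> complex) \<Rightarrow> (nat \<Rightarrow> nat \<Rightarrow> real) \<Rightarrow> real
      \<Rightarrow> (nat \<Rightarrow> real) \<Rightarrow> complex" where
  "CMW l F \<rho> T \<theta> =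
     (LBINT s:{0..T}. of_real (bump_weight (s / T)) * orbit_product l F \<rho> s \<theta>) / of_real T"

lemma space_torus_measure: "space torus_measure = torus"
  by (auto simp: torus_measure_def torus_def space_PiM space_restrict_space PiE_def Pi_def)

lemma prob_space_torus_measure: "prob_space torus_measure"
  unfolding torus_measure_def
  by (intro prob_space_PiM prob_spaceI)
     (simp add: space_restrict_space emeasure_restrict_space)

lemma space_rotation_measure: "space rotation_measure = {\<rho>. \<forall>j. \<rho> j \<in> {1..2}}"
  by (auto simp: rotation_measure_def space_PiM space_restrict_space PiE_def Pi_def)

lemma prob_space_rotation_measure: "prob_space rotation_measure"
  unfolding rotation_measure_def
  by (intro prob_space_PiM prob_spaceI)
     (simp add: space_restrict_space emeasure_restrict_space)

end

theory Submission
  imports Defs "HOL-Computational_Algebra.Polynomial" "HOL-Real_Asymp.Real_Asymp"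
begin

text \<open>
  Expanding every \<open>F i\<close> in its Fourier series turns an orbit average into an absolutely
  convergent sum over tuples \<open>g\<close> of frequencies. Each term is a coefficient, times a phase of
  modulus one, times the weighted mean of the single oscillation \<open>s \<mapsto> e\<^sup>2\<^sup>\<pi>\<^sup>i\<^sup>a\<^sup>s\<close>,
  where \<open>a\<close> is the sum over \<open>i\<close> of the pairings of the \<open>i\<close>-th frequency with \<open>\<rho> i\<close>. The mean of
  the constant oscillation is exactly 1, so the zero tuple contributes exactly the product of the
  integrals, and the error is the sum over the nonzero tuples.

  Two estimates control that sum. First, the bump is smooth, vanishes to infinite order at 0 and 1,
  and its \<open>m\<close>-th derivative is at most \<open>exp (9 m\<^sup>2)\<close>. Summing (or integrating) by parts \<open>m\<close> times
  therefore bounds the mean over a window of length \<open>X\<close> by a multiple of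
  \<open>(X + m + 1) exp (9 m\<^sup>2) (X d)\<^sup>-\<^sup>m\<close>, where \<open>d\<close> is the distance of \<open>a\<close> from the integers
  (\<open>bump_average_discrete_mean\<close>, \<open>bump_average_continuous_mean\<close>).

  Second, almost every rotation is nonresonant: there are \<open>\<gamma> > 0\<close> and \<open>B\<close> with
  \<open>d \<ge> \<gamma> exp (- B |g|\<^sup>1\<^sup>/\<^sup>2)\<close> for all nonzero tuples, \<open>|g|\<close> being the sum of the weighted norms of the
  entries (\<open>AE_nonresonant\<close>). Indeed a nonzero tuple comes within \<open>\<delta>\<close> of an integer with probability
  at most \<open>6 \<delta>\<close>. The thresholds \<open>freq_weight\<close>, a product of inverse squares over the nonzero entries, are
  summable over all frequencies, because their sum is an infinite product that converges; and they
  are bounded below by \<open>exp (- B |k|\<^sup>1\<^sup>/\<^sup>2)\<close>, because the weights \<open>jap j ^ \<eta>\<close> with \<open>\<eta> \<ge> 2\<close> make a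
  frequency of norm \<open>K\<close> so sparse that the logarithm of the product is of order \<open>K\<^sup>1\<^sup>/\<^sup>2\<close>.

  Now let \<open>L = ln X\<close>. Tuples with \<open>B |g|\<^sup>1\<^sup>/\<^sup>2 \<le> L / 4\<close> have \<open>X d \<ge> X\<^sup>1\<^sup>/\<^sup>2\<close> for large \<open>X\<close>, and about
  \<open>L / 36\<close> integrations by parts make their mean smaller than \<open>exp (- c L\<^sup>2)\<close>. The other tuples have
  norm at least a multiple of \<open>L\<^sup>2\<close>, so that analyticity makes their coefficients that small
  (\<open>weighted_fourier_tail\<close>). Any exponent below 2 is thus admissible; the proof takes 3/2.
\<close>

section \<open>Derivatives of the bump function\<close>

text \<open>The sum of the absolute values of the coefficients dominates a polynomial on the unit interval and is
  submultiplicative; differentiation costs only a factor equal to the degree. This is all that is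
  needed to follow the polynomials in the derivatives of the bump through their recursion.\<close>

definition coeff_norm :: "real poly \<Rightarrow> real" where
  "coeff_norm p = (\<Sum>i\<le>degree p. \<bar>coeff p i\<bar>)"

lemma coeff_norm_altdef: "degree p \<le> n \<Longrightarrow> coeff_norm p = (\<Sum>i\<le>n. \<bar>coeff p i\<bar>)"
  unfolding coeff_norm_def
  by (rule sum.mono_neutral_left) (auto simp: coeff_eq_0 not_le)

lemma coeff_norm_nonneg: "0 \<le> coeff_norm p"
  by (simp add: coeff_norm_def sum_nonneg)

lemma coeff_norm_0 [simp]: "coeff_norm 0 = 0"
  by (simp add: coeff_norm_def)

lemma coeff_norm_pCons [simp]: "coeff_norm (pCons a p) = \<bar>a\<bar> + coeff_norm p"
proof -
  have "coeff_norm (pCons a p) = (\<Sum>i\<le>Suc (degree p). \<bar>coeff (pCons a p) i\<bar>)"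
    by (rule coeff_norm_altdef) (simp add: degree_pCons_le)
  also have "\<dots> = \<bar>a\<bar> + coeff_norm p"
    by (subst sum.atMost_Suc_shift) (simp add: coeff_norm_def)
  finally show ?thesis .
qed

lemma coeff_norm_add: "coeff_norm (p + q) \<le> coeff_norm p + coeff_norm q"
proof -
  define n where "n = max (degree p) (degree q)"
  have "coeff_norm (p + q) = (\<Sum>i\<le>n. \<bar>coeff p i + coeff q i\<bar>)"
    using degree_add_le_max[of p q] by (simp add: coeff_norm_altdef n_def)
  also have "\<dots> \<le> (\<Sum>i\<le>n. \<bar>coeff p i\<bar> + \<bar>coeff q i\<bar>)"
    by (intro sum_mono) auto
  also have "\<dots> = coeff_norm p + coeff_norm q"
    by (simp add: sum.distrib coeff_norm_altdef[of p n] coeff_norm_altdef[of q n] n_def)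
  finally show ?thesis .
qed

lemma coeff_norm_smult: "coeff_norm (smult c p) = \<bar>c\<bar> * coeff_norm p"
  using degree_smult_le[of c p]
  by (simp add: coeff_norm_altdef[of _ "degree p"] abs_mult sum_distrib_left)

lemma coeff_norm_mult: "coeff_norm (p * q) \<le> coeff_norm p * coeff_norm q"
proof (induction p)
  case (pCons a p)
  have "coeff_norm (pCons a p * q) \<le> coeff_norm (smult a q) + coeff_norm (pCons 0 (p * q))"
    by (simp only: mult_pCons_left coeff_norm_add)
  also have "\<dots> \<le> \<bar>a\<bar> * coeff_norm q + coeff_norm p * coeff_norm q"
    using pCons.IH by (simp add: coeff_norm_smult)
  finally show ?case by (simp add: algebra_simps)
qed simp

lemma coeff_norm_pderiv: 
  assumes "degree p \<le> n" shows "coeff_norm (pderiv p) \<le> real n * coeff_norm p"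
proof -
  have "coeff_norm (pderiv p) = (\<Sum>i\<le>degree p. \<bar>coeff (pderiv p) i\<bar>)"
    by (rule coeff_norm_altdef) (simp add: degree_pderiv)
  also have "\<dots> \<le> (\<Sum>i\<le>degree p. real n * \<bar>coeff p (Suc i)\<bar>)"
  proof (rule sum_mono)
    fix i assume "i \<in> {..degree p}"
    show "\<bar>coeff (pderiv p) i\<bar> \<le> real n * \<bar>coeff p (Suc i)\<bar>"
    proof (cases "Suc i \<le> degree p")
      case True
      have "\<bar>coeff (pderiv p) i\<bar> = real (Suc i) * \<bar>coeff p (Suc i)\<bar>"
        by (simp add: coeff_pderiv abs_mult)
      also have "\<dots> \<le> real n * \<bar>coeff p (Suc i)\<bar>"
        using True assms by (intro mult_right_mono) auto
      finally show ?thesis .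
    next
      case False
      then show ?thesis by (simp add: coeff_pderiv coeff_eq_0)
    qed
  qed
  also have "\<dots> = real n * (\<Sum>i\<le>degree p. \<bar>coeff p (Suc i)\<bar>)"
    by (simp add: sum_distrib_left)
  also have "\<dots> \<le> real n * (\<Sum>i\<le>Suc (degree p). \<bar>coeff p i\<bar>)"
    by (intro mult_left_mono) (simp_all add: sum.atMost_Suc_shift del: sum.atMost_Suc)
  also have "(\<Sum>i\<le>Suc (degree p). \<bar>coeff p i\<bar>) = coeff_norm p"
    by (rule coeff_norm_altdef[symmetric]) simp
  finally show ?thesis .
qed

lemma abs_poly_le_coeff_norm:
  assumes "\<bar>x\<bar> \<le> 1" shows "\<bar>poly p x\<bar> \<le> coeff_norm p"
proof -
  have "\<bar>poly p x\<bar> \<le> (\<Sum>i\<le>degree p. \<bar>coeff p i * x ^ i\<bar>)"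
    unfolding poly_altdef by (rule sum_abs)
  also have "\<dots> \<le> (\<Sum>i\<le>degree p. \<bar>coeff p i\<bar> * 1)"
    unfolding abs_mult power_abs using assms
    by (intro sum_mono mult_left_mono power_le_one) auto
  finally show ?thesis by (simp add: coeff_norm_def)
qed

definition bump_exponent :: "real \<Rightarrow> real" where
  "bump_exponent x = inverse x * inverse (1 - x)"

text \<open>The exponent \<open>u = 1 / (x (1 - x))\<close> satisfies \<open>u' = - (1 - 2 x) u\<^sup>2\<close>, so the \<open>m\<close>-th derivative of
  \<open>exp (- u)\<close> has the form \<open>p\<^sub>m u\<^sup>2\<^sup>m exp (- u)\<close> with a polynomial \<open>p\<^sub>m\<close>. Differentiating once more and
  clearing denominators with \<open>1 = u x (1 - x)\<close> gives the recursion.\<close>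

fun bump_poly :: "nat \<Rightarrow> real poly" where
  "bump_poly 0 = 1"
| "bump_poly (Suc m) =
     pderiv (bump_poly m) * ([:0, 1, -1:] * [:0, 1, -1:])
     + [:1, -2:] * bump_poly m
     - smult (2 * real m) ([:1, -2:] * [:0, 1, -1:] * bump_poly m)"

definition bump_deriv :: "nat \<Rightarrow> real \<Rightarrow> real" where
  "bump_deriv m x =
     (if 0 < x \<and> x < 1 then poly (bump_poly m) x * bump_exponent x ^ (2 * m) * exp (- bump_exponent x) else 0)"

text \<open>The factor \<open>27\<^sup>m m!\<close> bounds the norm of \<open>bump_poly m\<close> and the factor \<open>(2 m)!\<close> bounds
  \<open>u\<^sup>2\<^sup>m exp (- u)\<close>.\<close>

definition bump_bound :: "nat \<Rightarrow> real" where
  "bump_bound m = 27 ^ m * fact m * fact (2 * m)"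

lemma degree_bump_poly: "degree (bump_poly m) \<le> 3 * m"
proof (induction m)
  case (Suc m)
  have 1: "degree (pderiv (bump_poly m) * ([:0, 1, -1:] * [:0, 1, -1:])) \<le> 3 * Suc m"
  proof (cases "pderiv (bump_poly m) = 0")
    case False
    then have "degree (bump_poly m) \<noteq> 0" by (simp add: pderiv_eq_0_iff)
    then show ?thesis
      using Suc by (intro order.trans[OF degree_mult_le]) (simp add: degree_pderiv)
  qed simp
  have 2: "degree ([:1, -2:] * bump_poly m) \<le> 3 * Suc m"
    using Suc by (intro order.trans[OF degree_mult_le]) simp
  have 3: "degree ([:1, -2:] * [:0, 1, -1:] * bump_poly m) \<le> 3 * Suc m"
    using Suc by (intro order.trans[OF degree_mult_le]) simp
  show ?case
    unfolding bump_poly.simps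
    by (intro degree_diff_le degree_add_le 1 2 order.trans[OF degree_smult_le 3])
qed simp

text \<open>One step of the recursion multiplies the norm by at most \<open>24 m + 3 \<le> 27 (m + 1)\<close>: the derivative of a
  polynomial of degree at most \<open>3 m\<close> contributes \<open>12 m\<close>, the other two terms 3 and \<open>12 m\<close>.\<close>

lemma coeff_norm_bump_poly: "coeff_norm (bump_poly m) \<le> 27 ^ m * fact m"
proof (induction m)
  case 0
  show ?case by (simp add: one_pCons)
next
  case (Suc m)
  let ?q = "[:0, 1, -1:] :: real poly" and ?r = "[:1, -2:] :: real poly"
  let ?p = "bump_poly m"
  have c: "0 \<le> coeff_norm ?p" by (rule coeff_norm_nonneg)
  have 1: "coeff_norm (pderiv ?p * (?q * ?q)) \<le> (3 * real m * coeff_norm ?p) * 4"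
  proof (rule order.trans[OF coeff_norm_mult mult_mono])
    show "coeff_norm (pderiv ?p) \<le> 3 * real m * coeff_norm ?p"
      using coeff_norm_pderiv[OF degree_bump_poly] by simp
    show "coeff_norm (?q * ?q) \<le> 4"
      using coeff_norm_mult[of ?q ?q] by simp
  qed (use c in \<open>auto intro: coeff_norm_nonneg\<close>)
  have 2: "coeff_norm (?r * ?p) \<le> 3 * coeff_norm ?p"
    by (rule order.trans[OF coeff_norm_mult]) simp
  have 3: "coeff_norm (?r * ?q * ?p) \<le> 6 * coeff_norm ?p"
  proof (rule order.trans[OF coeff_norm_mult mult_right_mono])
    show "coeff_norm (?r * ?q) \<le> 6"
      by (rule order.trans[OF coeff_norm_mult]) simp
  qed (rule c)
  have "coeff_norm (bump_poly (Suc m)) \<le>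
      coeff_norm (pderiv ?p * (?q * ?q)) + coeff_norm (?r * ?p)
      + coeff_norm (smult (- (2 * real m)) (?r * ?q * ?p))"
    unfolding bump_poly.simps diff_conv_add_uminus smult_minus_left[symmetric]
    by (intro order.trans[OF coeff_norm_add] add_mono order.refl coeff_norm_add)
  also have "coeff_norm (smult (- (2 * real m)) (?r * ?q * ?p)) \<le> 2 * real m * (6 * coeff_norm ?p)"
    unfolding coeff_norm_smult using 3 by (intro mult_mono) (auto intro: coeff_norm_nonneg)
  finally have "coeff_norm (bump_poly (Suc m)) \<le> (24 * real m + 3) * coeff_norm ?p"
    using 1 2 by (simp add: algebra_simps)
  also have "\<dots> \<le> (27 * real (Suc m)) * (27 ^ m * fact m)"
    using Suc c by (intro mult_mono) auto
  finally show ?case by (simp add: algebra_simps)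
qed

lemma power_times_exp_minus_le:
  fixes u :: real assumes "0 \<le> u" shows "u ^ n * exp (- u) \<le> fact n"
proof -
  have "u ^ n / fact n \<le> (\<Sum>k. u ^ k / fact k)"
    using assms summable_exp_generic[of u]
    by (intro sum_le_suminf[of _ "{n}", simplified]) (auto simp: divide_inverse mult.commute)
  also have "\<dots> = exp u" by (simp add: exp_def divide_inverse mult.commute)
  finally show ?thesis by (simp add: exp_minus field_simps)
qed

lemma bump_exponent_pos: "0 < x \<Longrightarrow> x < 1 \<Longrightarrow> 0 < bump_exponent x"
  by (simp add: bump_exponent_def)

lemma bump_exponent_eq: "0 < x \<Longrightarrow> x < 1 \<Longrightarrow> bump_exponent x * (x * (1 - x)) = 1"
  by (simp add: bump_exponent_def field_simps)

lemma bump_deriv_eq_0: "\<not> (0 < x \<and> x < 1) \<Longrightarrow> bump_deriv m x = 0"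
  by (auto simp: bump_deriv_def)

lemma bump_bound_pos: "0 < bump_bound m"
  by (simp add: bump_bound_def)

text \<open>Trading \<open>n\<close> powers of \<open>u\<close> for powers of \<open>x (1 - x)\<close> shows vanishing to any order at the endpoints. The
  case \<open>n = 0\<close> is the uniform bound, and \<open>n = 2\<close> gives differentiability at 0 and 1.\<close>

lemma abs_bump_deriv_le_weighted:
  assumes "0 < x" "x < 1"
  shows "\<bar>bump_deriv m x\<bar> \<le> 27 ^ m * fact m * fact (2 * m + n) * (x * (1 - x)) ^ n"
proof -
  have e: "bump_exponent x ^ (2 * m) = bump_exponent x ^ (2 * m + n) * (x * (1 - x)) ^ n"
    using bump_exponent_eq[OF assms] by (simp add: power_add mult.assoc flip: power_mult_distrib)
  have "\<bar>bump_deriv m x\<bar> = \<bar>poly (bump_poly m) x\<bar> * (bump_exponent x ^ (2 * m + n) * exp (- bump_exponent x) * (x * (1 - x)) ^ n)"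
    unfolding bump_deriv_def e using assms bump_exponent_pos[OF assms] by (simp add: abs_mult)
  also have "\<dots> \<le> (27 ^ m * fact m) * (fact (2 * m + n) * (x * (1 - x)) ^ n)"
    using assms bump_exponent_pos[OF assms]
    by (intro mult_mono order.trans[OF abs_poly_le_coeff_norm coeff_norm_bump_poly]
        mult_right_mono power_times_exp_minus_le) auto
  finally show ?thesis by (simp add: mult_ac)
qed

lemma abs_bump_deriv_le: "\<bar>bump_deriv m x\<bar> \<le> bump_bound m"
  using abs_bump_deriv_le_weighted[of x m 0] bump_bound_pos[of m]
  by (cases "0 < x \<and> x < 1") (auto simp: bump_deriv_eq_0 bump_bound_def)

lemma has_real_derivative_0_quadratic:
  fixes f :: "real \<Rightarrow> real"
  assumes "\<And>x. \<bar>f x\<bar> \<le> C * (x - a)\<^sup>2"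
  shows "(f has_real_derivative 0) (at a)"
proof -
  have fa: "f a = 0" using assms[of a] by simp
  have "((\<lambda>x. (f x - f a) / (x - a)) \<longlongrightarrow> 0) (at a)"
  proof (rule Lim_null_comparison)
    show "\<forall>\<^sub>F x in at a. norm ((f x - f a) / (x - a)) \<le> C * \<bar>x - a\<bar>"
      using assms fa
      by (auto simp: eventually_at_filter field_simps power2_eq_square abs_mult
           intro!: always_eventually) 
    have "((\<lambda>x. C * \<bar>x - a\<bar>) \<longlongrightarrow> C * \<bar>a - a\<bar>) (at a)"
      by (intro tendsto_intros)
    then show "((\<lambda>x. C * \<bar>x - a\<bar>) \<longlongrightarrow> 0) (at a)" by simp
  qed
  then show ?thesis by (simp add: has_field_derivative_iff)
qed

text \<open>Inside the interval this is the recursion for \<open>bump_poly\<close>; at 0 and 1 all the derivatives vanish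
  quadratically, so that extending them by zero keeps them differentiable.\<close>

lemma bump_deriv_has_derivative:
  "(bump_deriv m has_real_derivative bump_deriv (Suc m) x) (at x)"
proof -
  consider "0 < x" "x < 1" | "x = 0 \<or> x = 1" | "x < 0" | "1 < x" by linarith
  then show ?thesis
  proof cases
    case 1
    let ?p = "bump_poly m" and ?u = "bump_exponent x"
    define q where "q = x * (1 - x)"
    have q: "?u * q = 1" using bump_exponent_eq[OF 1] by (simp add: q_def)
    have du: "(bump_exponent has_real_derivative - (1 - 2 * x) * ?u ^ 2) (at x)"
      unfolding bump_exponent_def [abs_def] using 1
      by (auto intro!: derivative_eq_intros simp: field_simps power2_eq_square)
    have dp: "((\<lambda>x. bump_exponent x ^ (2 * m)) has_real_derivative
        real (2 * m) * (- (1 - 2 * x) * ?u ^ (2 * m + 1))) (at x)"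
    proof (cases m)
      case 0
      then show ?thesis by simp
    next
      case (Suc j)
      show ?thesis
        by (rule DERIV_cong, rule DERIV_power[OF du])
           (simp add: Suc power2_eq_square)
    qed
    define U where "U = ?u ^ (2 * m)"
    have dp: "((\<lambda>x. bump_exponent x ^ (2 * m)) has_real_derivative
        real (2 * m) * (- (1 - 2 * x) * (U * ?u))) (at x)"
      using dp by (simp add: U_def mult_ac)
    have de: "((\<lambda>x. exp (- bump_exponent x)) has_real_derivative exp (- ?u) * ((1 - 2 * x) * ?u ^ 2)) (at x)"
      by (rule DERIV_cong[OF DERIV_fun_exp[OF DERIV_minus[OF du]]]) (simp only: mult_minus_left minus_minus)
    have "((\<lambda>x. poly ?p x * bump_exponent x ^ (2 * m) * exp (- bump_exponent x)) has_real_derivative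
        (poly (pderiv ?p) x * U + real (2 * m) * (- (1 - 2 * x) * (U * ?u)) * poly ?p x) * exp (- ?u)
        + exp (- ?u) * ((1 - 2 * x) * ?u ^ 2) * (poly ?p x * U)) (at x)"
      using DERIV_mult[OF DERIV_mult[OF poly_DERIV dp] de] unfolding U_def .
    also have "(poly (pderiv ?p) x * U + real (2 * m) * (- (1 - 2 * x) * (U * ?u)) * poly ?p x) * exp (- ?u)
        + exp (- ?u) * ((1 - 2 * x) * ?u ^ 2) * (poly ?p x * U)
      = (poly (pderiv ?p) x * (?u * q) ^ 2
         - 2 * real m * (1 - 2 * x) * (?u * q) * poly ?p x * ?u
         + (1 - 2 * x) * poly ?p x * ?u ^ 2) * U * exp (- ?u)"
      unfolding q by (simp add: algebra_simps)
    also have "\<dots> = (poly (pderiv ?p) x * q ^ 2 - 2 * real m * (1 - 2 * x) * q * poly ?p x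
         + (1 - 2 * x) * poly ?p x) * ?u ^ (2 * Suc m) * exp (- ?u)"
      by (simp add: U_def power2_eq_square algebra_simps)
    also have "\<dots> = bump_deriv (Suc m) x"
    proof -
      have "poly (bump_poly (Suc m)) x = poly (pderiv ?p) x * q ^ 2
          - 2 * real m * (1 - 2 * x) * q * poly ?p x + (1 - 2 * x) * poly ?p x"
        by (simp add: q_def power2_eq_square) algebra
      with 1 show ?thesis by (simp only: bump_deriv_def if_True simp_thms)
    qed
    finally have "((\<lambda>x. poly ?p x * bump_exponent x ^ (2 * m) * exp (- bump_exponent x)) has_real_derivative
        bump_deriv (Suc m) x) (at x)" .
    then show ?thesis
      by (rule has_field_derivative_transform_within_open[of _ _ _ "{0<..<1}"])
         (use 1 in \<open>auto simp: bump_deriv_def\<close>)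
  next
    case 2
    define C :: real where "C = 27 ^ m * fact m * fact (2 * m + 2)"
    have "(bump_deriv m has_real_derivative 0) (at x)"
    proof (rule has_real_derivative_0_quadratic)
      fix y
      show "\<bar>bump_deriv m y\<bar> \<le> C * (y - x)\<^sup>2"
      proof (cases "0 < y \<and> y < 1")
        case True
        have "\<bar>bump_deriv m y\<bar> \<le> C * (y * (1 - y))\<^sup>2"
          unfolding C_def using True by (intro abs_bump_deriv_le_weighted) auto
        also have "\<dots> \<le> C * (y - x)\<^sup>2"
        proof (intro mult_left_mono)
          have "\<bar>y * (1 - y)\<bar> \<le> \<bar>y - x\<bar>"
            using 2 True by (auto simp: abs_mult mult_left_le mult_left_le_one_le)
          then show "(y * (1 - y))\<^sup>2 \<le> (y - x)\<^sup>2"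
            by (simp only: abs_le_square_iff)
        qed (simp add: C_def)
        finally show ?thesis .
      qed (auto simp: bump_deriv_eq_0 C_def)
    qed
    with 2 show ?thesis by (auto simp: bump_deriv_eq_0)
  next
    case 3
    have "((\<lambda>_. 0) has_real_derivative bump_deriv (Suc m) x) (at x)"
      using 3 by (simp add: bump_deriv_eq_0)
    then show ?thesis
      by (rule has_field_derivative_transform_within_open[of _ _ _ "{..<0}"])
         (use 3 in \<open>auto simp: bump_deriv_eq_0\<close>)
  next
    case 4
    have "((\<lambda>_. 0) has_real_derivative bump_deriv (Suc m) x) (at x)"
      using 4 by (simp add: bump_deriv_eq_0)
    then show ?thesis
      by (rule has_field_derivative_transform_within_open[of _ _ _ "{1<..}"])
         (use 4 in \<open>auto simp: bump_deriv_eq_0\<close>)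
  qed
qed

lemma fact_le_exp: "fact n \<le> exp (real n ^ 2)"
proof -
  have "(fact n :: real) \<le> real n ^ n"
    by (rule order.trans[OF fact_le_power]) simp
  also have "\<dots> \<le> exp (real n) ^ n"
  proof (rule power_mono)
    show "real n \<le> exp (real n)"
      using exp_ge_add_one_self[of "real n"] by linarith
  qed simp
  finally show ?thesis by (simp add: power2_eq_square exp_of_nat_mult)
qed

text \<open>Growth of order \<open>exp (O (m\<^sup>2))\<close> is far from sharp, but it is harmless: with \<open>m\<close> a small multiple of
  \<open>ln X\<close> it is absorbed by half of the gain \<open>X\<^sup>-\<^sup>m\<^sup>/\<^sup>2\<close>.\<close>

lemma bump_bound_le_exp: "bump_bound m \<le> exp (9 * real m ^ 2)"
proof -
  have e: "(27 :: real) \<le> exp 4"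
    using exp_lower_Taylor_quadratic[of 1] power_mono[of "5 / 2" "exp 1 :: real" 4]
    by (simp flip: exp_of_nat_mult add: power_divide)
  have "(27 :: real) ^ m \<le> exp 4 ^ m"
    using e by (intro power_mono) auto
  also have "\<dots> = exp (4 * real m)" by (simp flip: exp_of_nat_mult add: mult.commute)
  also have "\<dots> \<le> exp (4 * real m ^ 2)"
    by (cases m) (auto simp: power2_eq_square algebra_simps)
  finally have 1: "(27 :: real) ^ m \<le> exp (4 * real m ^ 2)" .
  have "bump_bound m \<le> exp (4 * real m ^ 2) * exp (real m ^ 2) * exp (real (2 * m) ^ 2)"
    unfolding bump_bound_def by (intro mult_mono 1 fact_le_exp) auto
  also have "\<dots> = exp (9 * real m ^ 2)"
    by (simp flip: exp_add add: power_mult_distrib)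
  finally show ?thesis .
qed

section \<open>Weighted exponential sums\<close>

text \<open>Backward differences, rather than forward ones, keep the sums below indexed by natural numbers: the bump
  vanishes on the negative axis, so nothing is lost at the index 0.\<close>

fun backward_diff :: "real \<Rightarrow> nat \<Rightarrow> (real \<Rightarrow> real) \<Rightarrow> real \<Rightarrow> real" where
  "backward_diff h 0 f x = f x"
| "backward_diff h (Suc m) f x = backward_diff h m f x - backward_diff h m f (x - h)"

lemma backward_diff_has_derivative:
  assumes "\<And>x. (f has_real_derivative f' x) (at x)"
  shows "(backward_diff h m f has_real_derivative backward_diff h m f' x) (at x)"
proof (induction m arbitrary: x)
  case 0
  then show ?case using assms by simp
next
  case (Suc m)
  have "((\<lambda>x. backward_diff h m f (x - h)) has_real_derivative backward_diff h m f' (x - h) * 1) (at x)"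
    by (rule DERIV_chain2[OF Suc]) (auto intro!: derivative_eq_intros)
  with Suc show ?case by (auto intro!: derivative_eq_intros)
qed

text \<open>The mean value theorem turns each difference into \<open>h\<close> times a derivative. The order \<open>j\<close> of the derivative
  has to vary in the induction.\<close>

lemma abs_backward_diff_bump_deriv_le:
  assumes "0 \<le> h"
  shows "\<bar>backward_diff h m (bump_deriv j) x\<bar> \<le> h ^ m * bump_bound (m + j)"
proof (induction m arbitrary: j x)
  case 0
  then show ?case by (simp add: abs_bump_deriv_le)
next
  case (Suc m)
  show ?case
  proof (cases "h = 0")
    case False
    with assms have "x - h < x" by simp
    from MVT2[OF this, of "backward_diff h m (bump_deriv j)" "backward_diff h m (bump_deriv (Suc j))"]
    obtain z where "backward_diff h m (bump_deriv j) x - backward_diff h m (bump_deriv j) (x - h)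
        = h * backward_diff h m (bump_deriv (Suc j)) z"
      using backward_diff_has_derivative[OF bump_deriv_has_derivative] by auto
    then have "\<bar>backward_diff h (Suc m) (bump_deriv j) x\<bar>
        = h * \<bar>backward_diff h m (bump_deriv (Suc j)) z\<bar>"
      using assms by (simp add: abs_mult)
    also have "\<dots> \<le> h * (h ^ m * bump_bound (m + Suc j))"
      using assms by (intro mult_left_mono Suc.IH)
    finally show ?thesis by simp
  qed simp
qed

lemma backward_diff_bump_deriv_eq_0:
  assumes "0 \<le> h" "x \<le> 0 \<or> 1 + real m * h \<le> x"
  shows "backward_diff h m (bump_deriv j) x = 0"
  using assms(2)
proof (induction m arbitrary: x)
  case (Suc m)
  have "x \<le> 0 \<or> 1 + real m * h \<le> x" "x - h \<le> 0 \<or> 1 + real m * h \<le> x - h"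
    using Suc.prems assms(1) by (auto simp: algebra_simps)
  then show ?case by (simp add: Suc.IH)
qed (auto simp: bump_deriv_eq_0)

lemma summation_by_parts_step:
  fixes z :: complex and f :: "real \<Rightarrow> real"
  assumes "f (- h) = 0" "f (real R * h) = 0"
  shows "(1 - z) * (\<Sum>n<Suc R. of_real (f (real n * h)) * z ^ n)
       = (\<Sum>n<Suc R. of_real (f (real n * h) - f (real n * h - h)) * z ^ n)"
proof -
  have "z * (\<Sum>n<Suc R. of_real (f (real n * h)) * z ^ n)
      = (\<Sum>n<R. of_real (f (real n * h)) * z ^ Suc n)"
    using assms by (simp add: sum_distrib_left mult_ac)
  also have "\<dots> = (\<Sum>n<Suc R. of_real (f (real n * h - h)) * z ^ n)"
    using assms by (subst sum.lessThan_Suc_shift) (simp add: algebra_simps)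
  finally show ?thesis
    by (simp only: left_diff_distrib of_real_diff sum_subtractf mult_1_left)
qed

lemma summation_by_parts_bump:
  fixes z :: complex
  assumes "0 \<le> h" "1 + real m * h \<le> real R * h"
  shows "(1 - z) ^ m * (\<Sum>n<Suc R. of_real (bump_deriv 0 (real n * h)) * z ^ n)
       = (\<Sum>n<Suc R. of_real (backward_diff h m (bump_deriv 0) (real n * h)) * z ^ n)"
  using assms(2)
proof (induction m)
  case (Suc m)
  have le: "1 + real m * h \<le> real R * h"
    using Suc.prems assms(1) by (simp add: algebra_simps)
  have "(1 - z) ^ Suc m * (\<Sum>n<Suc R. of_real (bump_deriv 0 (real n * h)) * z ^ n)
      = (1 - z) * (\<Sum>n<Suc R. of_real (backward_diff h m (bump_deriv 0) (real n * h)) * z ^ n)"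
    using Suc.IH[OF le] by (simp only: power_Suc mult.assoc)
  also have "\<dots> = (\<Sum>n<Suc R. of_real (backward_diff h (Suc m) (bump_deriv 0) (real n * h)) * z ^ n)"
    unfolding backward_diff.simps using le assms(1)
    by (intro summation_by_parts_step backward_diff_bump_deriv_eq_0) auto
  finally show ?case .
qed simp

text \<open>Multiplying the sum by \<open>1 - z\<close> replaces the sampled weight by its difference. After \<open>m\<close> steps there are
  \<open>N + m + 1\<close> terms, each at most \<open>N\<^sup>-\<^sup>m\<close> times the bound on the \<open>m\<close>-th derivative.\<close>

lemma norm_bump_exponential_sum_le:
  fixes z :: complex
  assumes "norm z = 1" "N > 0"
  shows "norm (1 - z) ^ m * norm (\<Sum>n<N. of_real (bump_deriv 0 (real n / real N)) * z ^ n)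
     \<le> (real N + real m + 1) * (bump_bound m / real N ^ m)"
proof -
  define h where "h = 1 / real N"
  have h: "0 \<le> h" "real N * h = 1" using assms by (auto simp: h_def)
  have S: "(\<Sum>n<N. of_real (bump_deriv 0 (real n / real N)) * z ^ n)
      = (\<Sum>n<Suc (N + m). of_real (bump_deriv 0 (real n * h)) * z ^ n)" (is "?S = ?S'")
    using assms by (intro sum.mono_neutral_cong_left) (auto simp: h_def bump_deriv_eq_0)
  have "norm (1 - z) ^ m * norm ?S = norm ((1 - z) ^ m * ?S')"
    unfolding S norm_mult norm_power ..
  also have "(1 - z) ^ m * ?S'
      = (\<Sum>n<Suc (N + m). of_real (backward_diff h m (bump_deriv 0) (real n * h)) * z ^ n)"
    using h by (intro summation_by_parts_bump) (auto simp: distrib_right)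
  also have "norm \<dots> \<le> (\<Sum>n<Suc (N + m). h ^ m * bump_bound m)"
    using abs_backward_diff_bump_deriv_le[OF h(1), of m 0] assms
    by (intro sum_norm_le) (auto simp: norm_mult norm_power)
  also have "\<dots> = (real N + real m + 1) * (bump_bound m / real N ^ m)"
    by (simp add: h_def power_one_over divide_inverse power_inverse add_ac)
  finally show ?thesis .
qed

text \<open>Below \<open>1/4\<close> the mean value theorem applies, the cosine being at least \<open>1/2\<close> there; above \<open>1/4\<close>
  monotonicity of the sine suffices.\<close>

lemma abs_le_abs_sin_pi:
  assumes "\<bar>b\<bar> \<le> 1 / 2" shows "\<bar>b\<bar> \<le> \<bar>sin (pi * b)\<bar>"
proof -
  have pos: "b \<le> sin (pi * b)" if b: "0 \<le> b" "b \<le> 1 / 2" for b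
  proof (cases "b \<le> 1 / 4")
    case True
    show ?thesis
    proof (cases "b = 0")
      case False
      obtain y where y: "0 < y" "y < pi * b" "sin (pi * b) - sin 0 = (pi * b - 0) * cos y"
        using MVT2[of 0 "pi * b" sin cos] False b by auto
      have "1 / 2 \<le> cos (pi / 4)"
        by (simp add: cos_45 real_le_rsqrt)
      also have "\<dots> \<le> cos y"
      proof (rule cos_monotone_0_pi_le)
        have "pi * b \<le> pi * (1 / 4)" using True by (intro mult_left_mono) auto
        then show "y \<le> pi / 4" using y by linarith
      qed (use y in auto)
      finally have "b * (2 * (1 / 2)) \<le> b * (pi * cos y)"
        using b pi_ge_two by (intro mult_left_mono mult_mono) auto
      with y show ?thesis by (simp add: mult_ac)
    qed simp
  next
    case False
    have "b \<le> sin (pi / 4)" using b by (simp add: sin_45) (smt (verit) real_le_rsqrt one_power2 four_x_squared)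
    also have "\<dots> \<le> sin (pi * b)"
      using False b mult_left_mono[of "1 / 4" b pi] mult_left_mono[of b "1 / 2" pi]
      by (intro sin_monotone_2pi_le) auto
    finally show ?thesis .
  qed
  show ?thesis
    using pos[of b] pos[of "- b"] assms by (cases "0 \<le> b") auto
qed

definition circle_exp :: "real \<Rightarrow> complex" where
  "circle_exp x = cis (2 * pi * x)"

lemma norm_circle_exp [simp]: "norm (circle_exp x) = 1"
  by (simp add: circle_exp_def)

lemma circle_exp_0 [simp]: "circle_exp 0 = 1"
  by (simp add: circle_exp_def)

lemma circle_exp_add: "circle_exp (x + y) = circle_exp x * circle_exp y"
  by (simp add: circle_exp_def cis_mult algebra_simps)

lemma circle_exp_mult_nat: "circle_exp (x * real n) = circle_exp x ^ n"
  unfolding circle_exp_def Complex.DeMoivre by (rule arg_cong[of _ _ cis]) simp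

lemma circle_exp_int [simp]: "circle_exp (of_int n) = 1"
  by (simp add: circle_exp_def complex_eq_iff)

text \<open>The modulus of \<open>1 - e\<^sup>2\<^sup>\<pi>\<^sup>i\<^sup>a\<close> is \<open>2 |sin (\<pi> b)|\<close>, where \<open>b\<close> is the difference between \<open>a\<close> and the
  nearest integer.\<close>

lemma norm_one_minus_circle_exp_ge:
  assumes "\<And>n :: int. d \<le> \<bar>a - of_int n\<bar>"
  shows "2 * d \<le> norm (1 - circle_exp a)"
proof -
  define b where "b = a - of_int (round a)"
  have b: "\<bar>b\<bar> \<le> 1 / 2"
    using of_int_round_abs_le[of a] by (simp add: b_def abs_minus_commute)
  have "circle_exp a = circle_exp b"
    using circle_exp_add[of b "of_int (round a)"] by (simp add: b_def)
  moreover have "norm (1 - circle_exp b) ^ 2 = (2 * \<bar>sin (pi * b)\<bar>) ^ 2"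
  proof -
    have "norm (1 - circle_exp b) ^ 2 = (1 - cos (2 * pi * b)) ^ 2 + sin (2 * pi * b) ^ 2"
      by (simp add: circle_exp_def cmod_power2)
    also have "\<dots> = 2 - 2 * cos (2 * (pi * b))"
      using sin_cos_squared_add[of "2 * pi * b"] by (simp add: power2_eq_square algebra_simps)
    also have "\<dots> = (2 * \<bar>sin (pi * b)\<bar>) ^ 2"
      by (simp only: cos_double_sin) (simp add: power_mult_distrib)
    finally show ?thesis .
  qed
  ultimately have "norm (1 - circle_exp a) = 2 * \<bar>sin (pi * b)\<bar>"
    by (metis abs_ge_zero mult_nonneg_nonneg norm_ge_zero power2_eq_imp_eq zero_le_numeral)
  moreover have "d \<le> \<bar>b\<bar>" unfolding b_def by (rule assms)
  ultimately show ?thesis using abs_le_abs_sin_pi[OF b] by linarith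
qed

section \<open>Fourier transform of the bump function\<close>

definition bump_mass :: real where
  "bump_mass = (LBINT x. bump_deriv 0 x)"

lemma continuous_bump_deriv: "continuous_on A (bump_deriv m)"
  by (meson DERIV_isCont bump_deriv_has_derivative continuous_at_imp_continuous_on)

lemma borel_measurable_bump_deriv [measurable]: "bump_deriv m \<in> borel_measurable borel"
  by (rule borel_measurable_continuous_onI) (rule continuous_bump_deriv)

lemma bump_deriv_0: "bump_deriv 0 x = (if 0 < x \<and> x < 1 then exp (- bump_exponent x) else 0)"
  by (simp add: bump_deriv_def)

lemma bump_deriv_0_nonneg: "0 \<le> bump_deriv 0 x"
  by (simp add: bump_deriv_0)

lemma integrable_bump_times_bounded:
  fixes f :: "real \<Rightarrow> complex"
  assumes [measurable]: "f \<in> borel_measurable borel" and "\<And>x. norm (f x) \<le> B"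
  shows "integrable lborel (\<lambda>x. of_real (bump_deriv m x) * f x)"
proof (rule Bochner_Integration.integrable_bound)
  show "integrable lborel (\<lambda>x :: real. indicator {0..1} x *\<^sub>R (bump_bound m * B))"
    by (intro integrable_scaleR_left integrable_real_indicator) auto
  show "AE x in lborel. norm (of_real (bump_deriv m x) * f x)
      \<le> norm (indicator {0..1} x *\<^sub>R (bump_bound m * B))"
  proof (rule AE_I2)
    fix x
    have "\<bar>bump_deriv m x\<bar> * norm (f x) \<le> bump_bound m * B"
      using assms(2)[of x] bump_bound_pos[of m] by (intro mult_mono abs_bump_deriv_le) auto
    then show "norm (of_real (bump_deriv m x) * f x)
        \<le> norm (indicator {0..1} x *\<^sub>R (bump_bound m * B))"
      by (cases "x \<in> {0..1}") (auto simp: norm_mult bump_deriv_eq_0)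
  qed
qed simp

lemma circle_exp_measurable [measurable]: "circle_exp \<in> borel_measurable borel"
  unfolding circle_exp_def [abs_def]
  by (intro borel_measurable_continuous_onI continuous_intros)

lemma integrable_bump_circle_exp:
  "integrable lborel (\<lambda>x. of_real (bump_deriv m x) * circle_exp (a * x))"
  by (rule integrable_bump_times_bounded[where B = 1]) simp_all

lemma integrable_bump_deriv: "integrable lborel (bump_deriv m)"
  using integrable_Re[OF integrable_bump_circle_exp[of m 0]] by simp

lemma bump_deriv_0_ge:
  assumes "1 / 3 \<le> x" "x \<le> 1 / 2" shows "exp (- 6) \<le> bump_deriv 0 x"
proof -
  have "inverse x * inverse (1 - x) \<le> 3 * 2"
    using assms by (intro mult_mono) (auto simp: field_simps)
  then show ?thesis using assms by (simp add: bump_deriv_0 bump_exponent_def)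
qed

lemma bump_mass_pos: "0 < bump_mass"
proof -
  have "0 < exp (- 6 :: real) * (LBINT x:{1/3..1/2::real}. 1)"
    by (simp add: set_lebesgue_integral_def)
  also have "\<dots> = (LBINT x. exp (- 6 :: real) * indicator {1/3..1/2::real} x)"
    by (simp add: set_lebesgue_integral_def)
  also have "\<dots> \<le> bump_mass"
    unfolding bump_mass_def
  proof (rule integral_mono)
    show "exp (- 6) * indicator {1/3..1/2} x \<le> bump_deriv 0 x" for x :: real
      using bump_deriv_0_ge[of x] by (auto simp: indicator_def bump_deriv_0_nonneg)
  qed (auto intro!: integrable_bump_deriv)
  finally show ?thesis .
qed

text \<open>Integration by parts: the product of a bump derivative with the oscillation vanishes at both ends, so
  its derivative integrates to zero.\<close>

lemma bump_fourier_step: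
  "(LBINT x. of_real (bump_deriv (Suc m) x) * circle_exp (a * x))
     = - (2 * of_real pi * \<i> * of_real a) * (LBINT x. of_real (bump_deriv m x) * circle_exp (a * x))"
proof -
  define c where "c = 2 * of_real pi * \<i> * complex_of_real a"
  have e: "circle_exp (a * x) = exp (c * of_real x)" for x
    by (simp add: circle_exp_def c_def cis_conv_exp mult_ac)
  have d: "((\<lambda>x. of_real (bump_deriv m x) * circle_exp (a * x)) has_vector_derivative
      of_real (bump_deriv (Suc m) x) * circle_exp (a * x)
      + c * (of_real (bump_deriv m x) * circle_exp (a * x))) (at x within A)" for x A
  proof -
    have "((\<lambda>x. exp (c * of_real x)) has_vector_derivative c * exp (c * of_real x)) (at x within A)"
      by (rule has_vector_derivative_real_field) (auto intro!: derivative_eq_intros)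
    moreover have "((\<lambda>x. complex_of_real (bump_deriv m x)) has_vector_derivative
        of_real (bump_deriv (Suc m) x)) (at x within A)"
      using bump_deriv_has_derivative[of m x]
      by (intro has_vector_derivative_of_real has_vector_derivative_at_within)
         (simp add: has_real_derivative_iff_has_vector_derivative)
    ultimately show ?thesis
      unfolding e
      by (intro has_vector_derivative_eq_rhs[OF has_vector_derivative_mult])
         (auto simp: algebra_simps)
  qed
  let ?g = "\<lambda>x. of_real (bump_deriv (Suc m) x) * circle_exp (a * x)
      + c * (of_real (bump_deriv m x) * circle_exp (a * x))"
  have int: "integrable lborel ?g"
    by (rule Bochner_Integration.integrable_add[OF integrable_bump_circle_exp
          integrable_mult_right[OF integrable_bump_circle_exp]])
  have "(?g has_integral (of_real (bump_deriv m 1) * circle_exp (a * 1)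
      - of_real (bump_deriv m 0) * circle_exp (a * 0))) {0..1}"
    by (rule fundamental_theorem_of_calculus) (auto intro: d)
  then have "(?g has_integral 0) {0..1}" by (simp add: bump_deriv_eq_0)
  then have "((\<lambda>x. if x \<in> {0..1} then ?g x else 0) has_integral 0) UNIV"
    by (simp only: has_integral_restrict_UNIV)
  also have "(\<lambda>x. if x \<in> {0..1} then ?g x else 0) = ?g"
    by (rule ext) (auto simp: bump_deriv_eq_0)
  finally have "(LBINT x. ?g x) = 0"
    using has_integral_integral_lborel[OF int] by (rule has_integral_unique[symmetric])
  then have "(LBINT x. of_real (bump_deriv (Suc m) x) * circle_exp (a * x))
      + c * (LBINT x. of_real (bump_deriv m x) * circle_exp (a * x)) = 0"
    by (simp add: integrable_bump_circle_exp)
  then show ?thesis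
    unfolding c_def[symmetric] mult_minus_left by (simp only: eq_neg_iff_add_eq_0)
qed

lemma norm_bump_fourier_le:
  "(2 * pi * \<bar>a\<bar>) ^ m * norm (LBINT x. of_real (bump_deriv 0 x) * circle_exp (a * x)) \<le> bump_bound m"
proof -
  have "(2 * pi * \<bar>a\<bar>) ^ m * norm (LBINT x. of_real (bump_deriv 0 x) * circle_exp (a * x))
     = norm (LBINT x. of_real (bump_deriv m x) * circle_exp (a * x))"
  proof (induction m)
    case (Suc m)
    then show ?case
      by (simp only: bump_fourier_step) (simp add: norm_mult)
  qed simp
  also have "\<dots> \<le> (LBINT x. norm (of_real (bump_deriv m x) * circle_exp (a * x)))"
    by (rule integral_norm_bound)
  also have "\<dots> \<le> (LBINT x:{0..1::real}. bump_bound m)"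
    unfolding set_lebesgue_integral_def
  proof (rule integral_mono)
    show "norm (of_real (bump_deriv m x) * circle_exp (a * x)) \<le> indicator {0..1} x *\<^sub>R bump_bound m"
      for x
      using abs_bump_deriv_le[of m x] by (cases "x \<in> {0..1}") (auto simp: norm_mult bump_deriv_eq_0)
    show "integrable lborel (\<lambda>x :: real. indicator {0..1} x *\<^sub>R bump_bound m)"
      by (intro integrable_scaleR_left integrable_real_indicator) auto
  qed (intro integrable_norm integrable_bump_circle_exp)
  also have "\<dots> = bump_bound m" by (simp add: set_lebesgue_integral_def)
  finally show ?thesis .
qed

section \<open>Smooth averages of a single oscillation\<close>

lemma bump_weight_eq: "bump_weight x = bump_deriv 0 x / bump_mass"
proof -
  have "(LBINT t:{0<..<1}. exp (- (inverse t * inverse (1 - t)))) = bump_mass"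
    unfolding set_lebesgue_integral_def bump_mass_def
    by (intro Bochner_Integration.integral_cong) (auto simp: bump_deriv_0 bump_exponent_def)
  then show ?thesis by (auto simp: bump_weight_def bump_deriv_0 bump_exponent_def)
qed

definition discrete_mean :: "nat \<Rightarrow> real \<Rightarrow> complex" where
  "discrete_mean N a =
     (\<Sum>n<N. of_real (bump_weight (real n / real N)) * circle_exp (a * real n))
     / of_real (\<Sum>s<N. bump_weight (real s / real N))"

definition continuous_mean :: "real \<Rightarrow> real \<Rightarrow> complex" where
  "continuous_mean T a =
     (LBINT s:{0..T}. of_real (bump_weight (s / T)) * circle_exp (a * s)) / of_real T"

text \<open>What the discrete and the continuous weighted means have in common: \<open>W a\<close> is the mean of the oscillation
  of frequency \<open>a\<close> over a window of length \<open>X\<close>. The decay is stated for every number \<open>m\<close> of integrations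
  by parts, because \<open>m\<close> is later chosen as a function of \<open>X\<close>.\<close>

definition bump_average :: "real \<Rightarrow> real \<Rightarrow> (real \<Rightarrow> complex) \<Rightarrow> bool" where
  "bump_average K X W \<longleftrightarrow>
     W 0 = 1 \<and> (\<forall>a. norm (W a) \<le> 1) \<and>
     (\<forall>a d m. 0 < d \<longrightarrow> (\<forall>n :: int. d \<le> \<bar>a - of_int n\<bar>) \<longrightarrow>
        norm (W a) \<le> K * (X + real m + 1) * bump_bound m / (X * d) ^ m)"

lemma discrete_mean_unnormalised:
  "discrete_mean N a =
     (\<Sum>n<N. of_real (bump_deriv 0 (real n / real N)) * circle_exp (a * real n))
     / of_real (\<Sum>s<N. bump_deriv 0 (real s / real N))"
  using bump_mass_pos
  by (simp add: discrete_mean_def bump_weight_eq flip: sum_divide_distrib)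

text \<open>A lower bound independent of \<open>N\<close> is enough: the true order of the sum is \<open>N\<close>, but a factor \<open>N\<close> is
  negligible against the decay of the exponential sums. The sample at \<open>N div 2\<close> alone provides it, as
  it lies between \<open>1/3\<close> and \<open>1/2\<close>.\<close>

lemma bump_sum_ge:
  assumes "2 \<le> N"
  shows "exp (- 6) \<le> (\<Sum>s<N. bump_deriv 0 (real s / real N))"
proof -
  have "2 * (N div 2) \<le> N" "N \<le> 3 * (N div 2)" using assms by presburger+
  then have "real (2 * (N div 2)) \<le> real N" "real N \<le> real (3 * (N div 2))"
    by (simp_all only: of_nat_le_iff)
  then have "exp (- 6) \<le> bump_deriv 0 (real (N div 2) / real N)"
    using assms by (intro bump_deriv_0_ge) (auto simp: field_simps)
  also have "\<dots> \<le> (\<Sum>s<N. bump_deriv 0 (real s / real N))"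
    using assms by (intro member_le_sum) (auto simp: bump_deriv_0_nonneg)
  finally show ?thesis .
qed

lemma bump_average_discrete_mean:
  assumes "2 \<le> N" shows "bump_average (exp 6) (real N) (discrete_mean N)"
proof -
  define A where "A = (\<Sum>s<N. bump_deriv 0 (real s / real N))"
  have A: "exp (- 6) \<le> A" "0 < A"
    using bump_sum_ge[OF assms] order.strict_trans2[OF exp_gt_zero bump_sum_ge[OF assms]]
    by (simp_all add: A_def)
  have norm_eq: "norm (discrete_mean N a)
      = norm (\<Sum>n<N. of_real (bump_deriv 0 (real n / real N)) * circle_exp (a * real n)) / A" for a
    using A by (simp add: discrete_mean_unnormalised A_def[symmetric] norm_divide)
  have "discrete_mean N 0 = 1"
    unfolding discrete_mean_unnormalised using A by (simp add: A_def flip: of_real_sum)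
  moreover have "norm (discrete_mean N a) \<le> 1" for a
  proof -
    have "norm (\<Sum>n<N. of_real (bump_deriv 0 (real n / real N)) * circle_exp (a * real n)) \<le> A"
      unfolding A_def by (intro sum_norm_le) (simp add: norm_mult bump_deriv_0_nonneg)
    then show ?thesis using A by (simp add: norm_eq)
  qed
  moreover have "norm (discrete_mean N a)
      \<le> exp 6 * (real N + real m + 1) * bump_bound m / (real N * d) ^ m"
    if d: "0 < d" "\<And>n :: int. d \<le> \<bar>a - of_int n\<bar>" for a d m
  proof -
    define S where "S = norm (\<Sum>n<N. of_real (bump_deriv 0 (real n / real N)) * circle_exp a ^ n)"
    have "d ^ m * S \<le> norm (1 - circle_exp a) ^ m * S"
      using norm_one_minus_circle_exp_ge[of d a] d
      by (intro mult_right_mono power_mono) (auto simp: S_def)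
    also have "\<dots> \<le> (real N + real m + 1) * (bump_bound m / real N ^ m)"
      unfolding S_def using assms by (intro norm_bump_exponential_sum_le) auto
    finally have "S \<le> (real N + real m + 1) * (bump_bound m / real N ^ m) / d ^ m"
      using d by (subst pos_le_divide_eq) (auto simp: mult.commute)
    also have "\<dots> = (real N + real m + 1) * bump_bound m / (real N * d) ^ m"
      by (simp add: power_mult_distrib)
    finally have S: "S \<le> (real N + real m + 1) * bump_bound m / (real N * d) ^ m" .
    have "norm (discrete_mean N a) = S / A"
      by (simp add: norm_eq circle_exp_mult_nat S_def)
    also have "\<dots> \<le> ((real N + real m + 1) * bump_bound m / (real N * d) ^ m) / exp (- 6)"
    proof (rule frac_le[OF _ S])
      show "0 \<le> (real N + real m + 1) * bump_bound m / (real N * d) ^ m"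
        using d bump_bound_pos[of m] by (intro divide_nonneg_nonneg mult_nonneg_nonneg) auto
    qed (use A in auto)
    also have "\<dots> = exp 6 * (real N + real m + 1) * bump_bound m / (real N * d) ^ m"
      by (simp add: exp_minus divide_inverse mult_ac)
    finally show ?thesis .
  qed
  ultimately show ?thesis by (simp add: bump_average_def)
qed

lemma continuous_mean_eq:
  assumes "0 < T"
  shows "continuous_mean T a =
    (LBINT x. of_real (bump_deriv 0 x) * circle_exp (a * T * x)) / of_real bump_mass"
proof -
  have "(LBINT s:{0..T}. of_real (bump_weight (s / T)) * circle_exp (a * s))
      = (LBINT s. of_real (bump_deriv 0 (s / T) / bump_mass) * circle_exp (a * s))"
    unfolding set_lebesgue_integral_def
    using assms by (intro Bochner_Integration.integral_cong)
      (auto simp: bump_weight_eq indicator_def bump_deriv_eq_0 field_simps)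
  also have "\<dots> = of_real T * (LBINT x. of_real (bump_deriv 0 x / bump_mass) * circle_exp (a * T * x))"
    using lborel_integral_real_affine[of T
        "\<lambda>s. of_real (bump_deriv 0 (s / T) / bump_mass) * circle_exp (a * s)" 0] assms
    by (simp add: scaleR_conv_of_real mult_ac)
  also have "(\<lambda>x. of_real (bump_deriv 0 x / bump_mass) * circle_exp (a * T * x))
      = (\<lambda>x. of_real (bump_deriv 0 x) * circle_exp (a * T * x) / of_real bump_mass)"
    by (simp add: fun_eq_iff)
  finally show ?thesis using assms by (simp add: continuous_mean_def)
qed

lemma bump_average_continuous_mean:
  assumes "0 < T" shows "bump_average (1 / bump_mass) T (continuous_mean T)"
proof -
  have norm_eq: "norm (continuous_mean T a)
      = norm (LBINT x. of_real (bump_deriv 0 x) * circle_exp (a * T * x)) / bump_mass" for a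
    using bump_mass_pos by (simp add: continuous_mean_eq[OF assms] norm_divide)
  have "continuous_mean T 0 = 1"
    using bump_mass_pos by (simp add: continuous_mean_eq[OF assms] bump_mass_def)
  moreover have "norm (continuous_mean T a) \<le> 1" for a
  proof -
    have "norm (LBINT x. of_real (bump_deriv 0 x) * circle_exp (a * T * x)) \<le>
        (LBINT x. norm (of_real (bump_deriv 0 x) * circle_exp (a * T * x)))"
      by (rule integral_norm_bound)
    also have "\<dots> = bump_mass"
      unfolding bump_mass_def
      by (intro Bochner_Integration.integral_cong) (auto simp: norm_mult bump_deriv_0_nonneg)
    finally show ?thesis using bump_mass_pos by (simp add: norm_eq)
  qed
  moreover have "norm (continuous_mean T a)
      \<le> 1 / bump_mass * (T + real m + 1) * bump_bound m / (T * d) ^ m"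
    if d: "0 < d" "\<And>n :: int. d \<le> \<bar>a - of_int n\<bar>" for a d m
  proof -
    define S where "S = norm (LBINT x. of_real (bump_deriv 0 x) * circle_exp (a * T * x))"
    have "T * d \<le> 2 * pi * \<bar>a * T\<bar>"
    proof -
      have "1 * (T * d) \<le> (2 * pi) * (T * \<bar>a\<bar>)"
        using d(1) d(2)[of 0] assms pi_ge_two by (intro mult_mono) auto
      then show ?thesis using assms by (simp add: abs_mult mult_ac)
    qed
    then have "(T * d) ^ m * S \<le> (2 * pi * \<bar>a * T\<bar>) ^ m * S"
      using d assms by (intro mult_right_mono power_mono) (auto simp: S_def)
    also have "\<dots> \<le> 1 * bump_bound m"
      unfolding S_def using norm_bump_fourier_le[of "a * T" m] by simp
    also have "\<dots> \<le> (T + real m + 1) * bump_bound m"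
      using assms bump_bound_pos[of m] by (intro mult_right_mono) auto
    finally have S: "S \<le> (T + real m + 1) * bump_bound m / (T * d) ^ m"
      using d assms by (simp add: pos_le_divide_eq mult.commute)
    have "norm (continuous_mean T a) = S / bump_mass"
      by (simp add: norm_eq S_def)
    also have "\<dots> \<le> ((T + real m + 1) * bump_bound m / (T * d) ^ m) / bump_mass"
      using bump_mass_pos S by (intro divide_right_mono) auto
    finally show ?thesis by (simp add: divide_inverse mult_ac)
  qed
  ultimately show ?thesis by (simp add: bump_average_def)
qed

text \<open>The choice \<open>m = \<lfloor>L / 36\<rfloor>\<close> makes \<open>9 m\<^sup>2 \<le> m L / 4\<close>, half of the gain \<open>m L / 2\<close> from the factor
  \<open>(X d)\<^sup>-\<^sup>m\<close> with \<open>X = exp L\<close> and \<open>d = X\<^sup>-\<^sup>1\<^sup>/\<^sup>2\<close>. What remains is \<open>m L / 4\<close>, which is at least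
  \<open>L\<^sup>2 / 144 - L / 4\<close>.\<close>

lemma bump_average_of_nonresonant:
  assumes W: "bump_average K (exp L) W" and "0 \<le> K" "36 \<le> L"
    and d: "\<And>n :: int. exp (- L / 2) \<le> \<bar>a - of_int n\<bar>"
  shows "norm (W a) \<le> 3 * K * exp (L + L / 4 - L\<^sup>2 / 144)"
proof -
  define m where "m = nat \<lfloor>L / 36\<rfloor>"
  have m: "real m \<le> L / 36" "L / 36 - 1 \<le> real m" using assms(3) by (simp_all add: m_def) linarith+
  have "norm (W a) \<le> K * (exp L + real m + 1) * bump_bound m / (exp L * exp (- L / 2)) ^ m"
    using W d unfolding bump_average_def by (meson exp_gt_zero)
  also have "exp L * exp (- L / 2) = exp (L / 2)"
    by (simp flip: exp_add)
  also have "exp (L / 2) ^ m = exp (real m * L / 2)"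
    by (simp flip: exp_of_nat_mult)
  also have "K * (exp L + real m + 1) * bump_bound m / exp (real m * L / 2)
      = K * ((exp L + real m + 1) * (bump_bound m * exp (- (real m * L / 2))))"
    by (simp add: exp_minus field_simps)
  also have "\<dots> \<le> K * ((3 * exp L) * (exp (9 * real m ^ 2) * exp (- (real m * L / 2))))"
  proof (intro mult_left_mono mult_mono mult_right_mono bump_bound_le_exp)
    have "real m + 1 \<le> exp L" using m assms(3) exp_ge_add_one_self[of L] by linarith
    then show "exp L + real m + 1 \<le> 3 * exp L" by simp
  qed (use assms bump_bound_pos[of m] in auto)
  also have "\<dots> = 3 * K * exp (L + 9 * real m ^ 2 - real m * L / 2)"
  proof -
    have "exp (L + 9 * real m ^ 2 - real m * L / 2)
        = exp L * (exp (9 * real m ^ 2) * exp (- (real m * L / 2)))"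
      by (simp flip: exp_add)
    then show ?thesis by simp
  qed
  also have "\<dots> \<le> 3 * K * exp (L + L / 4 - L\<^sup>2 / 144)"
  proof (intro mult_left_mono, unfold exp_le_cancel_iff)
    have "9 * real m ^ 2 \<le> real m * (L / 4)"
      using mult_left_mono[OF m(1), of "9 * real m"] by (simp add: power2_eq_square mult_ac)
    moreover have "(L / 36 - 1) * (L / 4) \<le> real m * (L / 4)"
      using m assms(3) by (intro mult_right_mono) auto
    ultimately show "L + 9 * real m ^ 2 - real m * L / 2 \<le> L + L / 4 - L\<^sup>2 / 144"
      by (simp add: power2_eq_square algebra_simps)
  qed (use assms in auto)
  finally show ?thesis .
qed

text \<open>The frequencies are split at \<open>B * sqrt (w k) = ln X / 4\<close>. Below, the small divisor is at least
  \<open>X\<^sup>-\<^sup>1\<^sup>/\<^sup>2\<close> and the mean is tiny. Above, the mean is only known to be at most 1, but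
  \<open>w k\<close> is at least a multiple of \<open>(ln X)\<^sup>2\<close> and the exponential weight in the summability assumption
  supplies the decay. The constant does not depend on the phases \<open>u\<close>, which is what makes the final
  bound uniform on the torus.\<close>

lemma weighted_fourier_tail:
  fixes C :: "'k \<Rightarrow> complex" and \<alpha> w :: "'k \<Rightarrow> real"
  assumes sm: "(\<lambda>k. norm (C k) * exp (\<tau> * w k)) summable_on I" and "0 < \<tau>"
    and w: "\<And>k. k \<in> I \<Longrightarrow> 0 \<le> w k"
    and small: "\<And>k n. k \<in> I \<Longrightarrow> \<gamma> * exp (- (B * sqrt (w k))) \<le> \<bar>\<alpha> k - of_int n\<bar>"
    and "0 < \<gamma>" "0 < B" "0 \<le> K"
  shows "\<exists>D. \<forall>\<^sub>F X in at_top. \<forall>W u s. bump_average K X W \<longrightarrow> (\<forall>k\<in>I. norm (u k) \<le> 1) \<longrightarrow>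
     ((\<lambda>k. C k * u k * W (\<alpha> k)) has_sum s) I \<longrightarrow> norm s \<le> D * exp (- (ln X powr (3 / 2)))"
proof -
  define S where "S = infsum (\<lambda>k. norm (C k) * exp (\<tau> * w k)) I"
  define c where "c = \<tau> / (16 * B\<^sup>2)"
  have c: "0 < c" using assms by (simp add: c_def)
  have "\<forall>\<^sub>F L :: real in at_top. L + L / 4 - L\<^sup>2 / 144 \<le> - (L powr (3 / 2))"
    by real_asymp
  moreover have "\<forall>\<^sub>F L :: real in at_top. - (c * L\<^sup>2) \<le> - (L powr (3 / 2))"
    using c by real_asymp
  moreover have "\<forall>\<^sub>F L :: real in at_top. 36 \<le> L" by real_asymp
  moreover have "\<forall>\<^sub>F L :: real in at_top. - 4 * ln \<gamma> \<le> L" by real_asymp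
  ultimately have "\<forall>\<^sub>F L in at_top. L + L / 4 - L\<^sup>2 / 144 \<le> - (L powr (3 / 2)) \<and>
      - (c * L\<^sup>2) \<le> - (L powr (3 / 2)) \<and> 36 \<le> L \<and> - 4 * ln \<gamma> \<le> L"
    by eventually_elim auto
  then have "\<forall>\<^sub>F X in at_top. ln X + ln X / 4 - (ln X)\<^sup>2 / 144 \<le> - (ln X powr (3 / 2)) \<and>
      - (c * (ln X)\<^sup>2) \<le> - (ln X powr (3 / 2)) \<and> 36 \<le> ln X \<and> - 4 * ln \<gamma> \<le> ln X"
    using ln_at_top by (rule eventually_compose_filterlim)
  with eventually_gt_at_top[of 0]
  have "\<forall>\<^sub>F X in at_top. \<forall>W u s. bump_average K X W \<longrightarrow> (\<forall>k\<in>I. norm (u k) \<le> 1) \<longrightarrow>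
     ((\<lambda>k. C k * u k * W (\<alpha> k)) has_sum s) I \<longrightarrow>
     norm s \<le> (S * (3 * K + 1)) * exp (- (ln X powr (3 / 2)))"
  proof eventually_elim
    case (elim X)
    define L where "L = ln X"
    have X: "X = exp L" using elim by (simp add: L_def)
    define E where "E = exp (- (L powr (3 / 2)))"
    show ?case
    proof (intro allI impI)
      fix W u s
      assume W: "bump_average K X W" and u: "\<forall>k\<in>I. norm (u k) \<le> 1"
        and s: "((\<lambda>k. C k * u k * W (\<alpha> k)) has_sum s) I"
      have W': "bump_average K (exp L) W" using W by (simp only: X)
      have L: "36 \<le> L" using elim by (simp add: L_def)
      have le: "norm (C k * u k * W (\<alpha> k)) \<le> norm (C k) * exp (\<tau> * w k) * ((3 * K + 1) * E)"
        if k: "k \<in> I" for k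
      proof -
        have "norm (C k * u k * W (\<alpha> k)) \<le> norm (C k) * 1 * norm (W (\<alpha> k))"
          unfolding norm_mult using u k by (intro mult_mono) auto
        also have "norm (C k) * 1 * norm (W (\<alpha> k)) \<le> norm (C k) * (exp (\<tau> * w k) * ((3 * K + 1) * E))"
          unfolding mult_1_right
        proof (rule mult_left_mono)
          show "norm (W (\<alpha> k)) \<le> exp (\<tau> * w k) * ((3 * K + 1) * E)"
          proof (cases "B * sqrt (w k) \<le> L / 4")
            case True
            have "exp (- L / 2) \<le> exp (ln \<gamma>) * exp (- (B * sqrt (w k)))"
              using True elim by (simp add: L_def flip: exp_add)
            also have "\<dots> = \<gamma> * exp (- (B * sqrt (w k)))" using assms by simp
            finally have "exp (- L / 2) \<le> \<bar>\<alpha> k - of_int n\<bar>" for n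
              using small[OF k, of n] by simp
            then have "norm (W (\<alpha> k)) \<le> 3 * K * exp (L + L / 4 - L\<^sup>2 / 144)"
              using W' L assms by (intro bump_average_of_nonresonant) auto
            also have "\<dots> \<le> (3 * K + 1) * E"
              using elim assms unfolding E_def by (intro mult_mono) (auto simp: L_def)
            also have "\<dots> \<le> exp (\<tau> * w k) * ((3 * K + 1) * E)"
              using w[OF k] assms mult_right_mono[of 1 "exp (\<tau> * w k)" "(3 * K + 1) * E"]
              by (simp add: E_def)
            finally show ?thesis .
          next
            case False
            have "(L / 4)\<^sup>2 \<le> (B * sqrt (w k))\<^sup>2"
              using False L by (intro power_mono) auto
            then have "L\<^sup>2 / (16 * B\<^sup>2) \<le> w k"
              using w[OF k] assms by (simp add: power_mult_distrib power_divide divide_le_eq mult_ac)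
            then have "\<tau> * (L\<^sup>2 / (16 * B\<^sup>2)) \<le> \<tau> * w k"
              using assms by (intro mult_left_mono) auto
            then have "c * L\<^sup>2 \<le> \<tau> * w k" by (simp add: c_def)
            moreover have "- (c * L\<^sup>2) \<le> - (L powr (3 / 2))" using elim by (simp add: L_def)
            ultimately have "1 \<le> exp (\<tau> * w k) * E"
              by (simp add: E_def flip: exp_add)
            also have "\<dots> \<le> exp (\<tau> * w k) * ((3 * K + 1) * E)"
              using assms by (intro mult_left_mono) (auto simp: E_def)
            finally show ?thesis using W by (auto simp: bump_average_def intro: order.trans)
          qed
        qed simp
        finally show ?thesis by (simp only: mult.assoc)
      qed
      have "norm s \<le> S * ((3 * K + 1) * E)"
      proof (rule norm_infsum_le)
        show "((\<lambda>k. norm (C k) * exp (\<tau> * w k) * ((3 * K + 1) * E)) has_sum S * ((3 * K + 1) * E)) I"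
          unfolding S_def by (intro has_sum_cmult_left has_sum_infsum sm)
      qed (use s le in auto)
      then show "norm s \<le> (S * (3 * K + 1)) * exp (- (ln X powr (3 / 2)))"
        by (simp add: E_def L_def mult.assoc)
    qed
  qed
  then show ?thesis by blast
qed

section \<open>Frequencies on the infinite torus\<close>

lemma one_le_jap: "1 \<le> jap j"
  by (simp add: jap_def)

text \<open>The terms of a convergent series tend to zero, and a nonzero integer has modulus at least one.\<close>

lemma freqs_eq: "freqs \<eta> = {k. finite {j. k j \<noteq> 0}}"
proof (intro set_eqI iffI CollectI)
  fix k assume "k \<in> freqs \<eta>"
  then have "(\<lambda>j. jap j ^ \<eta> * \<bar>real_of_int (k j)\<bar>) \<longlonglongrightarrow> 0"
    by (auto simp: freqs_def dest: summable_LIMSEQ_zero)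
  then have "\<forall>\<^sub>F j in sequentially. jap j ^ \<eta> * \<bar>real_of_int (k j)\<bar> < 1"
    by (rule order_tendstoD) simp
  then have "\<forall>\<^sub>F j in sequentially. k j = 0"
  proof eventually_elim
    case (elim j)
    have "1 * \<bar>real_of_int (k j)\<bar> \<le> jap j ^ \<eta> * \<bar>real_of_int (k j)\<bar>"
      by (intro mult_right_mono one_le_power one_le_jap) auto
    with elim show "k j = 0" by linarith
  qed
  then show "finite {j. k j \<noteq> 0}"
    by (simp add: eventually_cofinite flip: cofinite_eq_sequentially)
next
  fix k :: "nat \<Rightarrow> int" assume "k \<in> {k. finite {j. k j \<noteq> 0}}"
  then show "k \<in> freqs \<eta>"
    by (auto simp: freqs_def intro!: summable_finite[of "{j. k j \<noteq> 0}"])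
qed

lemma finite_support: "k \<in> freqs \<eta> \<Longrightarrow> finite {j. k j \<noteq> 0}"
  by (simp add: freqs_eq)

lemma zero_in_freqs: "(\<lambda>_. 0) \<in> freqs \<eta>"
  by (simp add: freqs_eq)

lemma countable_freqs: "countable (freqs \<eta>)"
proof (rule countable_subset)
  show "freqs \<eta> \<subseteq> range (\<lambda>xs j. if j < length xs then xs ! j else 0 :: int)"
  proof
    fix k assume "k \<in> freqs \<eta>"
    then obtain n where n: "\<And>j. k j \<noteq> 0 \<Longrightarrow> j < n"
      using finite_nat_bounded[OF finite_support] by blast
    have "k = (\<lambda>j. if j < length (map k [0..<n]) then map k [0..<n] ! j else 0)"
      using n by (fastforce simp: fun_eq_iff)
    then show "k \<in> range (\<lambda>xs j. if j < length xs then xs ! j else 0)" by blast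
  qed
qed simp

lemma freq_norm_eq:
  "k \<in> freqs \<eta> \<Longrightarrow> freq_norm \<eta> k = (\<Sum>j | k j \<noteq> 0. jap j ^ \<eta> * \<bar>real_of_int (k j)\<bar>)"
  unfolding freq_norm_def by (rule suminf_finite) (auto simp: finite_support)

lemma freq_norm_nonneg: "k \<in> freqs \<eta> \<Longrightarrow> 0 \<le> freq_norm \<eta> k"
  using one_le_jap by (simp add: freq_norm_eq sum_nonneg order.trans[OF zero_le_one])

definition freq_inner :: "(nat \<Rightarrow> int) \<Rightarrow> (nat \<Rightarrow> real) \<Rightarrow> real" where
  "freq_inner k x = (\<Sum>j | k j \<noteq> 0. real_of_int (k j) * x j)"

lemma freq_dot_of_real:
  "k \<in> freqs \<eta> \<Longrightarrow> freq_dot k (\<lambda>j. of_real (x j)) = of_real (freq_inner k x)"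
  unfolding freq_dot_def freq_inner_def
  by (subst suminf_finite[of "{j. k j \<noteq> 0}"]) (auto simp: finite_support)

text \<open>The threshold for the small divisor of \<open>k\<close>. Its product form makes it summable over all frequencies;
  \<open>Suc j\<close> instead of \<open>j\<close> avoids a division by zero at \<open>j = 0\<close>.\<close>

definition freq_weight :: "(nat \<Rightarrow> int) \<Rightarrow> real" where
  "freq_weight k = (\<Prod>j | k j \<noteq> 0. inverse ((real (Suc j) * real_of_int (k j))\<^sup>2))"

lemma freq_weight_pos: "0 < freq_weight k"
  unfolding freq_weight_def by (intro prod_pos) auto

lemma sum_inverse_squares_int:
  "(\<Sum>m \<in> {- int M..int M} - {0}. inverse (real_of_int m ^ 2)) = 2 * (\<Sum>i<M. inverse (real (Suc i) ^ 2))"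
proof (induction M)
  case (Suc M)
  have "{- int (Suc M)..int (Suc M)} - {0}
      = insert (int (Suc M)) (insert (- int (Suc M)) ({- int M..int M} - {0}))" by auto
  moreover have "(- 1 - real M)\<^sup>2 = (1 + real M)\<^sup>2"
    by (simp add: power2_eq_square algebra_simps)
  ultimately show ?case using Suc by (simp add: algebra_simps)
qed simp

lemma summable_inverse_squares: "summable (\<lambda>i. inverse (real (Suc i) ^ 2))"
  using inverse_squares_sums by (simp add: sums_iff inverse_eq_divide add.commute)

text \<open>A finite set of frequencies fits into a box, over which the sum factors into one-dimensional sums. The
  \<open>j\<close>-th factor is \<open>1 + O (1 / (j + 1)\<^sup>2)\<close>, so the products stay bounded as the box grows.\<close>

lemma summable_on_freq_weight: "freq_weight summable_on freqs \<eta>"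
proof (rule nonneg_bdd_above_summable_on)
  define q where "q = (\<Sum>i. inverse (real (Suc i) ^ 2))"
  have q_ge: "(\<Sum>i<M. inverse (real (Suc i) ^ 2)) \<le> q" for M
    unfolding q_def by (intro sum_le_suminf summable_inverse_squares) auto
  have q: "0 \<le> q" using q_ge[of 0] by simp
  define b :: "nat \<Rightarrow> int \<Rightarrow> real"
    where "b j m = (if m = 0 then 1 else inverse ((real (Suc j) * real_of_int m)\<^sup>2))" for j m
  have b_sum: "(\<Sum>m\<in>{- int M..int M}. b j m) \<le> exp (2 * q * inverse (real (Suc j) ^ 2))" for j M
  proof -
    have "(\<Sum>m\<in>{- int M..int M}. b j m) = 1 + (\<Sum>m\<in>{- int M..int M} - {0}. b j m)"
      by (subst sum.remove[of _ 0]) (auto simp: b_def)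
    also have "(\<Sum>m\<in>{- int M..int M} - {0}. b j m)
        = inverse (real (Suc j) ^ 2) * (\<Sum>m\<in>{- int M..int M} - {0}. inverse (real_of_int m ^ 2))"
      unfolding sum_distrib_left by (intro sum.cong) (auto simp: b_def power_mult_distrib)
    also have "\<dots> \<le> inverse (real (Suc j) ^ 2) * (2 * q)"
      unfolding sum_inverse_squares_int using q_ge by (intro mult_left_mono) auto
    finally have "(\<Sum>m\<in>{- int M..int M}. b j m) \<le> 1 + 2 * q * inverse (real (Suc j) ^ 2)"
      by (simp add: mult_ac)
    also have "\<dots> \<le> exp (2 * q * inverse (real (Suc j) ^ 2))" by (rule exp_ge_add_one_self)
    finally show ?thesis .
  qed
  show "bdd_above (sum freq_weight ` {F. F \<subseteq> freqs \<eta> \<and> finite F})"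
  proof (rule bdd_aboveI2, clarify)
    fix F assume F: "F \<subseteq> freqs \<eta>" "finite F"
    then have "finite (\<Union>k\<in>F. {j. k j \<noteq> 0})" by (auto intro: finite_support)
    then obtain n where n: "(\<Union>k\<in>F. {j. k j \<noteq> 0}) \<subseteq> {..<n}" by (meson finite_nat_bounded)
    have "finite ((\<lambda>(k, j). nat \<bar>k j\<bar>) ` (F \<times> {..<n}))" using F by auto
    then obtain M where M: "(\<lambda>(k, j). nat \<bar>k j\<bar>) ` (F \<times> {..<n}) \<subseteq> {..<M}"
      by (meson finite_nat_bounded)
    let ?P = "PiE {..<n} (\<lambda>_. {- int M..int M})"
    have "sum freq_weight F = (\<Sum>k\<in>F. \<Prod>j<n. b j (restrict k {..<n} j))"
    proof (rule sum.cong)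
      fix k assume "k \<in> F"
      then have "{j. k j \<noteq> 0} \<subseteq> {..<n}" using n by auto
      then show "freq_weight k = (\<Prod>j<n. b j (restrict k {..<n} j))"
        unfolding freq_weight_def by (intro prod.mono_neutral_cong_left) (auto simp: b_def)
    qed simp
    also have "\<dots> = (\<Sum>g\<in>(\<lambda>k. restrict k {..<n}) ` F. \<Prod>j<n. b j (g j))"
    proof (rule sum.reindex_cong[symmetric])
      show "inj_on (\<lambda>k. restrict k {..<n}) F"
      proof (rule inj_onI, rule ext)
        fix k k' j assume k: "k \<in> F" "k' \<in> F" "restrict k {..<n} = restrict k' {..<n}"
        show "k j = k' j"
        proof (cases "j < n")
          case True
          then show ?thesis using fun_cong[OF k(3), of j] by simp
        next
          case False
          then have "k j = 0" "k' j = 0" using n k by blast+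
          then show ?thesis by simp
        qed
      qed
    qed auto
    also have "\<dots> \<le> (\<Sum>g\<in>?P. \<Prod>j<n. b j (g j))"
    proof (rule sum_mono2)
      show "(\<lambda>k. restrict k {..<n}) ` F \<subseteq> ?P"
      proof clarify
        fix k assume k: "k \<in> F"
        have "k j \<in> {- int M..int M}" if "j < n" for j
        proof -
          have "nat \<bar>k j\<bar> < M" using M k that by (auto simp: image_subset_iff)
          then show ?thesis by auto
        qed
        then show "restrict k {..<n} \<in> ?P" by auto
      qed
    qed (auto intro!: finite_PiE prod_nonneg simp: b_def)
    also have "\<dots> = (\<Prod>j<n. \<Sum>m\<in>{- int M..int M}. b j m)"
      by (rule prod_sum_PiE[symmetric]) auto
    also have "\<dots> \<le> (\<Prod>j<n. exp (2 * q * inverse (real (Suc j) ^ 2)))"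
      by (intro prod_mono conjI b_sum sum_nonneg) (auto simp: b_def)
    also have "\<dots> = exp (2 * q * (\<Sum>j<n. inverse (real (Suc j) ^ 2)))"
      by (simp add: exp_sum sum_distrib_left)
    also have "\<dots> \<le> exp (2 * q * q)"
      using q q_ge by (simp add: mult_left_mono)
    finally show "sum freq_weight F \<le> exp (2 * q * q)" .
  qed
qed (simp add: freq_weight_pos less_imp_le)

lemma ln_le_fourth_root:
  fixes y :: real assumes "0 < y" shows "ln y \<le> 4 * y powr (1 / 4)"
proof -
  have "ln (y powr (1 / 4)) \<le> y powr (1 / 4)"
    using assms by (intro less_imp_le[OF ln_less_self]) auto
  then show ?thesis using assms by (simp add: ln_powr)
qed

lemma summable_jap: "summable (\<lambda>j. jap j powr (- 3 / 2))"
proof (rule summable_comparison_test_ev)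
  show "summable (\<lambda>j. real j powr (- 3 / 2))"
    by (subst summable_real_powr_iff) simp
  show "\<forall>\<^sub>F j in sequentially. norm (jap j powr (- 3 / 2)) \<le> real j powr (- 3 / 2)"
    using eventually_gt_at_top[of 0] by eventually_elim (simp add: jap_def max_def)
qed

text \<open>Each logarithm \<open>2 ln ((j + 1) |k\<^sub>j|)\<close> is at most a constant times the fourth root of its argument, hence at
  most \<open>16 x\<^sub>j\<^sup>1\<^sup>/\<^sup>2 (jap j)\<^sup>-\<^sup>3\<^sup>/\<^sup>4\<close>, where \<open>x\<^sub>j\<close> is the \<open>j\<close>-th term of the norm; this is where \<open>\<eta> \<ge> 2\<close> enters.
  The Cauchy-Schwarz inequality then gives a multiple of the square root of the norm, since
  \<open>(jap j)\<^sup>-\<^sup>3\<^sup>/\<^sup>2\<close> is summable.\<close>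

lemma freq_weight_lower_bound:
  assumes "2 \<le> \<eta>"
  shows "\<exists>B>0. \<forall>k\<in>freqs \<eta>. exp (- (B * sqrt (freq_norm \<eta> k))) \<le> freq_weight k"
proof -
  define Z where "Z = (\<Sum>j. jap j powr (- 3 / 2))"
  have Z_ge: "sum (\<lambda>j. jap j powr (- 3 / 2)) A \<le> Z" if "finite A" for A
    unfolding Z_def using that by (intro sum_le_suminf summable_jap) auto
  have Z: "0 < Z" using Z_ge[of "{0}"] by (simp add: jap_def)
  have "exp (- (16 * sqrt Z * sqrt (freq_norm \<eta> k))) \<le> freq_weight k" if k: "k \<in> freqs \<eta>" for k
  proof -
    let ?J = "{j. k j \<noteq> 0}"
    have fin: "finite ?J" by (rule finite_support[OF k])
    have quarter: "1 + - 3 / 4 = (1 / 4 :: real)" by simp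
    have termwise: "2 * ln (real (Suc j) * \<bar>real_of_int (k j)\<bar>)
        \<le> 16 * (\<bar>sqrt (jap j ^ \<eta> * \<bar>real_of_int (k j)\<bar>)\<bar> * \<bar>jap j powr (- 3 / 4)\<bar>)"
      if j: "j \<in> ?J" for j
    proof -
      define J and K :: real where "J = jap j" and "K = \<bar>real_of_int (k j)\<bar>"
      have J: "1 \<le> J" "real (Suc j) \<le> 2 * J" by (auto simp: J_def jap_def)
      have K: "1 \<le> K" using j by (auto simp: K_def)
      have "2 * ln (real (Suc j) * K) \<le> 2 * (4 * (real (Suc j) * K) powr (1 / 4))"
        using K by (intro mult_left_mono ln_le_fourth_root) auto
      also have "\<dots> \<le> 8 * (2 * J * K) powr (1 / 4)"
        using J K by (auto intro!: powr_mono2 mult_right_mono)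
      also have "(2 * J * K) powr (1 / 4) = 2 powr (1 / 4) * (J powr (1 / 4) * K powr (1 / 4))"
        using J K by (simp add: powr_mult)
      also have "\<dots> \<le> 2 powr 1 * (J powr (1 / 4) * K powr (1 / 2))"
        using J K by (intro mult_mono powr_mono) auto
      also have "J powr (1 / 4) = J powr 1 * J powr (- 3 / 4)"
          using powr_add[of J 1 "- 3 / 4"] by (simp only: quarter)
      also have "2 powr 1 * (J powr 1 * J powr (- 3 / 4) * K powr (1 / 2))
          = 2 * (sqrt (J ^ 2 * K) * J powr (- 3 / 4))"
        using J K by (simp add: real_sqrt_mult powr_half_sqrt)
      also have "\<dots> \<le> 2 * (sqrt (J ^ \<eta> * K) * J powr (- 3 / 4))"
        using J K assms
        by (intro mult_left_mono mult_right_mono real_sqrt_le_mono power_increasing) auto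
      finally show ?thesis using J K by (simp add: J_def K_def)
    qed
    have "(\<Sum>j\<in>?J. 2 * ln (real (Suc j) * \<bar>real_of_int (k j)\<bar>))
        \<le> 16 * (\<Sum>j\<in>?J. \<bar>sqrt (jap j ^ \<eta> * \<bar>real_of_int (k j)\<bar>)\<bar> * \<bar>jap j powr (- 3 / 4)\<bar>)"
      unfolding sum_distrib_left by (intro sum_mono termwise)
    also have "\<dots> \<le> 16 * (L2_set (\<lambda>j. sqrt (jap j ^ \<eta> * \<bar>real_of_int (k j)\<bar>)) ?J
        * L2_set (\<lambda>j. jap j powr (- 3 / 4)) ?J)"
      by (intro mult_left_mono L2_set_mult_ineq) auto
    also have "L2_set (\<lambda>j. sqrt (jap j ^ \<eta> * \<bar>real_of_int (k j)\<bar>)) ?J = sqrt (freq_norm \<eta> k)"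
    proof -
      have "0 \<le> jap j" for j using one_le_jap[of j] by linarith
      then show ?thesis by (simp add: L2_set_def freq_norm_eq[OF k])
    qed
    also have "L2_set (\<lambda>j. jap j powr (- 3 / 4)) ?J = sqrt (\<Sum>j\<in>?J. jap j powr (- 3 / 2))"
      by (simp add: L2_set_def power2_eq_square flip: powr_add)
    also have "16 * (sqrt (freq_norm \<eta> k) * sqrt (\<Sum>j\<in>?J. jap j powr (- 3 / 2)))
        \<le> 16 * (sqrt (freq_norm \<eta> k) * sqrt Z)"
      using Z_ge[OF fin] freq_norm_nonneg[OF k] by (intro mult_left_mono) auto
    finally have "exp (- (16 * sqrt Z * sqrt (freq_norm \<eta> k)))
        \<le> exp (- (\<Sum>j\<in>?J. 2 * ln (real (Suc j) * \<bar>real_of_int (k j)\<bar>)))"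
      by (simp add: mult_ac)
    also have "\<dots> = (\<Prod>j\<in>?J. exp (- (2 * ln (real (Suc j) * \<bar>real_of_int (k j)\<bar>))))"
      using fin by (simp add: exp_sum flip: sum_negf)
    also have "\<dots> = freq_weight k"
      unfolding freq_weight_def
    proof (rule prod.cong)
      fix j assume "j \<in> ?J"
      then have "0 < real (Suc j) * \<bar>real_of_int (k j)\<bar>" by simp
      then have "exp (- (2 * ln (real (Suc j) * \<bar>real_of_int (k j)\<bar>)))
          = inverse ((real (Suc j) * \<bar>real_of_int (k j)\<bar>) ^ 2)"
        by (simp add: exp_minus exp_double)
      then show "exp (- (2 * ln (real (Suc j) * \<bar>real_of_int (k j)\<bar>)))
          = inverse ((real (Suc j) * real_of_int (k j))\<^sup>2)"
        by (simp add: power_mult_distrib)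
    qed simp
    finally show ?thesis .
  qed
  then show ?thesis using Z by (intro exI[of _ "16 * sqrt Z"]) auto
qed

section \<open>Small divisors\<close>

text \<open>Redrawing the \<open>j\<close>-th coordinate independently does not change a product of probability measures. A bound
  that holds for the redrawn coordinate, whatever the others are, therefore holds for the product.\<close>

lemma emeasure_PiM_le_fibrewise:
  assumes M: "\<And>i. i \<in> I \<Longrightarrow> prob_space (M i)" and j: "j \<in> I"
    and A [measurable]: "A \<in> sets (PiM I M)"
    and fibre: "\<And>X. X \<in> space (PiM I M) \<Longrightarrow> emeasure (M j) {x \<in> space (M j). X(j := x) \<in> A} \<le> c"
  shows "emeasure (PiM I M) A \<le> c"
proof -
  interpret P: prob_space "PiM I M" by (rule prob_space_PiM) (rule M)
  interpret Mj: prob_space "M j" by (rule M[OF j])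
  interpret pair_sigma_finite "M j" "PiM I M" ..
  let ?r = "\<lambda>(x, X). X(j := x)"
  have eq: "distr (M j \<Otimes>\<^sub>M PiM I M) (PiM I M) ?r = PiM I M"
    using distr_pair_PiM_eq_PiM[of I M j] M j by (simp add: insert_absorb)
  have r [measurable]: "?r \<in> M j \<Otimes>\<^sub>M PiM I M \<rightarrow>\<^sub>M PiM I M"
    unfolding split_beta using j by (intro measurable_fun_upd[where J = I]) auto
  have "emeasure (PiM I M) A = emeasure (distr (M j \<Otimes>\<^sub>M PiM I M) (PiM I M) ?r) A"
    by (simp only: eq)
  also have "\<dots> = emeasure (M j \<Otimes>\<^sub>M PiM I M) (?r -` A \<inter> space (M j \<Otimes>\<^sub>M PiM I M))"
    by (rule emeasure_distr[OF r A])
  also have "\<dots> = (\<integral>\<^sup>+ X. emeasure (M j) ((\<lambda>x. (x, X)) -` (?r -` A \<inter> space (M j \<Otimes>\<^sub>M PiM I M))) \<partial>PiM I M)"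
    by (rule emeasure_pair_measure_alt2) (rule measurable_sets[OF r A])
  also have "\<dots> \<le> (\<integral>\<^sup>+ X. c \<partial>PiM I M)"
  proof (rule nn_integral_mono)
    fix X assume X: "X \<in> space (PiM I M)"
    then have "(\<lambda>x. (x, X)) -` (?r -` A \<inter> space (M j \<Otimes>\<^sub>M PiM I M)) = {x \<in> space (M j). X(j := x) \<in> A}"
      by (auto simp: space_pair_measure)
    then show "emeasure (M j) ((\<lambda>x. (x, X)) -` (?r -` A \<inter> space (M j \<Otimes>\<^sub>M PiM I M))) \<le> c"
      using fibre[OF X] by simp
  qed
  also have "\<dots> = c" by (simp add: P.emeasure_space_1)
  finally show ?thesis .
qed

text \<open>At most \<open>|p| + 2 d + 1\<close> integers are within reach of \<open>p x + b\<close>, and each of them claims an interval of length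
  \<open>2 d / |p|\<close>. For \<open>d > 1/2\<close> the bound exceeds the total mass 1.\<close>

lemma emeasure_near_integer_le:
  fixes p :: int and b d :: real
  assumes "p \<noteq> 0" "0 \<le> d"
  shows "emeasure (restrict_space lborel {1..2})
      {x \<in> {1..2}. \<exists>n :: int. \<bar>of_int p * x + b - of_int n\<bar> < d} \<le> ennreal (6 * d)"
proof -
  let ?E = "{x \<in> {1..2}. \<exists>n :: int. \<bar>of_int p * x + b - of_int n\<bar> < d}"
  have "?E = {x \<in> space borel. x \<in> {1..2} \<and> (\<exists>n :: int. \<bar>of_int p * x + b - of_int n\<bar> < d)}"
    by auto
  also have "\<dots> \<in> sets borel" by measurable
  finally have E: "?E \<in> sets borel" .
  have eq: "emeasure (restrict_space lborel {1..2}) ?E = emeasure lborel ?E"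
    by (rule emeasure_restrict_space) auto
  show ?thesis
  proof (cases "d \<le> 1 / 2")
    case False
    have "emeasure lborel ?E \<le> emeasure lborel {1..2::real}"
      by (intro emeasure_mono) auto
    also have "\<dots> \<le> ennreal (6 * d)"
      using False by (simp flip: ennreal_1 add: ennreal_leI)
    finally show ?thesis using eq by simp
  next
    case True
    define P where "P = \<bar>real_of_int p\<bar>"
    have P: "1 \<le> P" using assms by (simp add: P_def)
    define c where "c = min (of_int p + b) (2 * of_int p + b)"
    define S where "S = {\<lceil>c - d\<rceil>..\<lfloor>c + P + d\<rfloor>}"
    define J where "J n = {(of_int n - b) / of_int p - d / P..(of_int n - b) / of_int p + d / P}"
      for n :: int
    have sub: "?E \<subseteq> (\<Union>n\<in>S. J n)"
    proof clarify
      fix x n assume x: "x \<in> {1..2}" and n: "\<bar>of_int p * x + b - of_int n\<bar> < d"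
      have range: "c \<le> of_int p * x + b \<and> of_int p * x + b \<le> c + P"
      proof (cases "0 \<le> p")
        case p: True
        have "of_int p * 1 \<le> of_int p * x" "of_int p * x \<le> of_int p * 2"
          using x p by (intro mult_left_mono; simp)+
        then show ?thesis using p by (auto simp: c_def P_def)
      next
        case p: False
        have "of_int p * 2 \<le> of_int p * x" "of_int p * x \<le> of_int p * 1"
          using x p by (intro mult_left_mono_neg; simp)+
        then show ?thesis using p by (auto simp: c_def P_def)
      qed
      have "n \<in> S"
        using range n by (auto simp: S_def ceiling_le_iff le_floor_iff abs_less_iff)
      moreover have "x \<in> J n"
      proof -
        have "\<bar>x - (of_int n - b) / of_int p\<bar> = \<bar>of_int p * x + b - of_int n\<bar> / P"
          using assms unfolding P_def by (subst abs_divide[symmetric]) (simp add: field_simps)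
        also have "\<dots> \<le> d / P" using n P by (intro divide_right_mono) auto
        finally show ?thesis unfolding J_def by (auto simp: abs_le_iff)
      qed
      ultimately show "x \<in> (\<Union>n\<in>S. J n)" by blast
    qed
    have "emeasure lborel ?E \<le> emeasure lborel (\<Union>n\<in>S. J n)"
      using sub by (rule emeasure_mono) (auto simp: J_def S_def intro!: sets.finite_UN)
    also have "\<dots> \<le> (\<Sum>n\<in>S. emeasure lborel (J n))"
      by (rule emeasure_subadditive_finite) (auto simp: J_def S_def)
    also have "\<dots> = (\<Sum>n\<in>S. ennreal (2 * d / P))"
      using assms P by (intro sum.cong) (auto simp: J_def)
    also have "\<dots> = ennreal (real (card S) * (2 * d / P))"
      using assms P by (simp add: ennreal_of_nat_eq_real_of_nat flip: ennreal_mult)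
    also have "\<dots> \<le> ennreal (6 * d)"
    proof (rule ennreal_leI)
      have "real (card S) \<le> P + 2 * d + 1"
        using P assms by (simp add: S_def) linarith
      also have "\<dots> \<le> 3 * P" using P True by simp
      finally have "real (card S) * (2 * d / P) \<le> 3 * P * (2 * d / P)"
        using assms P by (intro mult_right_mono) auto
      then show "real (card S) * (2 * d / P) \<le> 6 * d" using P by simp
    qed
    finally show ?thesis using eq by simp
  qed
qed

lemma freq_inner_measurable_PiM:
  "freq_inner k \<in> borel_measurable (\<Pi>\<^sub>M j\<in>UNIV. restrict_space lborel A)"
proof -
  have "(\<lambda>x. x j) \<in> borel_measurable (\<Pi>\<^sub>M j\<in>UNIV. restrict_space lborel A)" for j :: nat
  proof (rule measurable_compose)
    show "(\<lambda>x. x j) \<in> (\<Pi>\<^sub>M j\<in>UNIV. restrict_space lborel A) \<rightarrow>\<^sub>M restrict_space lborel A"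
      by (rule measurable_component_singleton) simp
    show "(\<lambda>x. x) \<in> restrict_space lborel A \<rightarrow>\<^sub>M borel"
      by (rule measurable_restrict_space1) simp
  qed
  then show ?thesis
    unfolding freq_inner_def [abs_def] by (intro borel_measurable_sum borel_measurable_times) auto
qed

lemma freq_inner_measurable_rotation [measurable]: "freq_inner k \<in> borel_measurable rotation_measure"
  unfolding rotation_measure_def by (rule freq_inner_measurable_PiM)

lemma freq_inner_measurable_torus [measurable]: "freq_inner k \<in> borel_measurable torus_measure"
  unfolding torus_measure_def by (rule freq_inner_measurable_PiM)

lemma freq_inner_upd:
  assumes "finite {j. k j \<noteq> 0}" "k j \<noteq> 0"
  shows "freq_inner k (x(j := y)) = of_int (k j) * y + (\<Sum>i | k i \<noteq> 0 \<and> i \<noteq> j. of_int (k i) * x i)"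
proof -
  have eq: "{i. k i \<noteq> 0} - {j} = {i. k i \<noteq> 0 \<and> i \<noteq> j}" by auto
  show ?thesis
    unfolding freq_inner_def using assms
    by (subst sum.remove[of _ j]) (auto simp: eq intro!: sum.cong)
qed

lemma emeasure_rotation_near_integer_le:
  assumes k: "finite {j. k j \<noteq> 0}" "k \<noteq> (\<lambda>_. 0)" and d: "0 \<le> d"
  shows "emeasure rotation_measure
    {\<rho> \<in> space rotation_measure. \<exists>n :: int. \<bar>freq_inner k \<rho> + b - of_int n\<bar> < d} \<le> ennreal (6 * d)"
proof -
  obtain j where j: "k j \<noteq> 0" using k(2) by auto
  let ?A = "{\<rho> \<in> space rotation_measure. \<exists>n :: int. \<bar>freq_inner k \<rho> + b - of_int n\<bar> < d}"
  have A: "?A \<in> sets rotation_measure" by measurable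
  show ?thesis
  proof (subst rotation_measure_def, rule emeasure_PiM_le_fibrewise[of _ _ j])
    show "?A \<in> sets (\<Pi>\<^sub>M j\<in>UNIV. restrict_space lborel {1..2})"
      using A by (simp add: rotation_measure_def)
  next
    fix X assume X: "X \<in> space (\<Pi>\<^sub>M j\<in>(UNIV :: nat set). restrict_space lborel {1..2::real})"
    define c where "c = (\<Sum>i | k i \<noteq> 0 \<and> i \<noteq> j. of_int (k i) * X i) + b"
    have "{x \<in> space (restrict_space lborel {1..2}). X(j := x) \<in> ?A}
        \<subseteq> {x \<in> {1..2}. \<exists>n :: int. \<bar>of_int (k j) * x + c - of_int n\<bar> < d}"
      using k j by (auto simp: freq_inner_upd c_def space_restrict_space add.assoc)
    moreover have "{x \<in> {1..2}. \<exists>n :: int. \<bar>of_int (k j) * x + c - of_int n\<bar> < d}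
        \<in> sets (restrict_space lborel {1..2})"
    proof -
      have "{x \<in> {1..2}. \<exists>n :: int. \<bar>of_int (k j) * x + c - of_int n\<bar> < d}
          = {x \<in> space borel. x \<in> {1..2} \<and> (\<exists>n :: int. \<bar>of_int (k j) * x + c - of_int n\<bar> < d)}"
        by auto
      also have "\<dots> \<in> sets borel" by measurable
      finally show ?thesis by (auto simp: sets_restrict_space_iff)
    qed
    ultimately show "emeasure (restrict_space lborel {1..2})
        {x \<in> space (restrict_space lborel {1..2}). X(j := x) \<in> ?A} \<le> ennreal (6 * d)"
      using emeasure_near_integer_le[OF j d, of c] by (meson emeasure_mono order.trans)
  qed (auto intro!: prob_spaceI simp: space_restrict_space emeasure_restrict_space)
qed

text \<open>The frequency of the oscillation that the tuple \<open>k\<close> produces along the orbit with rotation vectors \<open>\<rho>\<close>.\<close>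

definition tuple_inner :: "nat \<Rightarrow> (nat \<Rightarrow> nat \<Rightarrow> int) \<Rightarrow> (nat \<Rightarrow> nat \<Rightarrow> real) \<Rightarrow> real" where
  "tuple_inner l k \<rho> = (\<Sum>i=1..l. freq_inner (k i) (\<rho> i))"

lemma tuple_inner_measurable [measurable]:
  "tuple_inner l k \<in> borel_measurable (\<Pi>\<^sub>M i\<in>{1..l}. rotation_measure)"
  unfolding tuple_inner_def [abs_def] by measurable

lemma emeasure_tuple_near_integer_le:
  assumes i: "i \<in> {1..l}" and k: "finite {j. k i j \<noteq> 0}" "k i \<noteq> (\<lambda>_. 0)" and d: "0 \<le> d"
  shows "emeasure (\<Pi>\<^sub>M i\<in>{1..l}. rotation_measure)
    {\<rho> \<in> space (\<Pi>\<^sub>M i\<in>{1..l}. rotation_measure). \<exists>n :: int. \<bar>tuple_inner l k \<rho> - of_int n\<bar> < d}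
    \<le> ennreal (6 * d)"
proof (rule emeasure_PiM_le_fibrewise[OF prob_space_rotation_measure i])
  let ?A = "{\<rho> \<in> space (\<Pi>\<^sub>M i\<in>{1..l}. rotation_measure). \<exists>n :: int. \<bar>tuple_inner l k \<rho> - of_int n\<bar> < d}"
  fix X assume X: "X \<in> space (\<Pi>\<^sub>M i\<in>{1..l}. rotation_measure)"
  define c where "c = (\<Sum>i'\<in>{1..l} - {i}. freq_inner (k i') (X i'))"
  have "tuple_inner l k (X(i := x)) = freq_inner (k i) x + c" for x
    unfolding tuple_inner_def c_def using i by (subst sum.remove[of _ i]) auto
  then have "{x \<in> space rotation_measure. X(i := x) \<in> ?A}
      \<subseteq> {x \<in> space rotation_measure. \<exists>n :: int. \<bar>freq_inner (k i) x + c - of_int n\<bar> < d}"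
    by auto
  moreover have "{x \<in> space rotation_measure. \<exists>n :: int. \<bar>freq_inner (k i) x + c - of_int n\<bar> < d}
      \<in> sets rotation_measure" by measurable
  ultimately show "emeasure rotation_measure {x \<in> space rotation_measure. X(i := x) \<in> ?A} \<le> ennreal (6 * d)"
    using emeasure_rotation_near_integer_le[OF k d, of c] by (meson emeasure_mono order.trans)
qed measurable

text \<open>By the union bound the event that \<open>f k\<close> comes within \<open>\<gamma> \<delta>\<^sub>k\<close> of an integer for some \<open>k\<close> has
  probability at most a constant times \<open>\<gamma>\<close>; the exceptional set lies in all these events, so \<open>\<gamma> \<rightarrow> 0\<close>
  makes it null. Scaling the thresholds by \<open>\<gamma>\<close> yields one constant valid for all \<open>k\<close> at once.\<close>

lemma AE_uniform_lower_bound_of_summable: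
  fixes f :: "'k \<Rightarrow> 'a \<Rightarrow> real" and \<delta> :: "'k \<Rightarrow> real"
  assumes "prob_space M" and I: "countable I" and \<delta>: "\<And>k. k \<in> I \<Longrightarrow> 0 < \<delta> k" "\<delta> summable_on I"
    and [measurable]: "\<And>k. k \<in> I \<Longrightarrow> f k \<in> borel_measurable M"
    and small: "\<And>k d. k \<in> I \<Longrightarrow> 0 \<le> d \<Longrightarrow>
      emeasure M {x \<in> space M. \<exists>n :: int. \<bar>f k x - of_int n\<bar> < d} \<le> ennreal (c * d)"
    and "0 \<le> c"
  shows "AE x in M. \<exists>\<gamma>>0. \<forall>k\<in>I. \<forall>n :: int. \<gamma> * \<delta> k \<le> \<bar>f k x - of_int n\<bar>"
proof -
  interpret prob_space M by fact
  define B where "B \<gamma> k = {x \<in> space M. \<exists>n :: int. \<bar>f k x - of_int n\<bar> < \<gamma> * \<delta> k}" for \<gamma> k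
  have B [measurable]: "B \<gamma> k \<in> sets M" if "k \<in> I" for \<gamma> k
    unfolding B_def using that by measurable
  define s where "s = infsum \<delta> I"
  have s: "0 \<le> s" unfolding s_def using \<delta> by (intro infsum_nonneg) (auto intro: less_imp_le)
  have sumB: "(\<integral>\<^sup>+k. ennreal (\<delta> k) \<partial>count_space I) = ennreal s"
  proof -
    have ab: "Infinite_Set_Sum.abs_summable_on \<delta> I"
      unfolding abs_summable_equivalent[symmetric]
      using \<delta> by (simp cong: summable_on_cong add: less_imp_le)
    then have "(\<integral>\<^sup>+k. ennreal (\<delta> k) \<partial>count_space I) = ennreal (infsetsum \<delta> I)"
      using \<delta> by (intro nn_integral_conv_infsetsum) (auto intro: less_imp_le)
    also have "infsetsum \<delta> I = s"
      unfolding s_def by (rule infsetsum_infsum[OF ab])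
    finally show ?thesis .
  qed
  have U: "emeasure M (\<Union>k\<in>I. B \<gamma> k) \<le> ennreal (c * \<gamma> * s)" if "0 \<le> \<gamma>" for \<gamma>
  proof -
    have "emeasure M (\<Union>k\<in>I. B \<gamma> k) = (\<integral>\<^sup>+x. indicator (\<Union>k\<in>I. B \<gamma> k) x \<partial>M)"
      using I by (intro nn_integral_indicator[symmetric] sets.countable_UN') auto
    also have "\<dots> \<le> (\<integral>\<^sup>+x. \<integral>\<^sup>+k. indicator (B \<gamma> k) x \<partial>count_space I \<partial>M)"
    proof (rule nn_integral_mono)
      fix x
      show "indicator (\<Union>k\<in>I. B \<gamma> k) x \<le> (\<integral>\<^sup>+k. indicator (B \<gamma> k) x \<partial>count_space I)"
      proof (cases "x \<in> (\<Union>k\<in>I. B \<gamma> k)")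
        case True
        then obtain k where k: "k \<in> I" "x \<in> B \<gamma> k" by auto
        then show ?thesis
          using nn_integral_ge_point[of k I "\<lambda>k. indicator (B \<gamma> k) x"] by (auto simp: indicator_def)
      qed simp
    qed
    also have "\<dots> = (\<integral>\<^sup>+k. \<integral>\<^sup>+x. indicator (B \<gamma> k) x \<partial>M \<partial>count_space I)"
      by (rule nn_integral_count_space_nn_integral) (use I in auto)
    also have "\<dots> \<le> (\<integral>\<^sup>+k. ennreal (c * \<gamma>) * ennreal (\<delta> k) \<partial>count_space I)"
    proof (rule nn_integral_mono)
      fix k assume "k \<in> space (count_space I)"
      then have k: "k \<in> I" by simp
      have "(\<integral>\<^sup>+x. indicator (B \<gamma> k) x \<partial>M) = emeasure M (B \<gamma> k)"
        using k by (intro nn_integral_indicator B)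
      also have "\<dots> \<le> ennreal (c * (\<gamma> * \<delta> k))"
        unfolding B_def using k \<delta>(1)[OF k] that by (intro small) auto
      also have "\<dots> = ennreal (c * \<gamma>) * ennreal (\<delta> k)"
        using that assms \<delta>(1)[OF k] by (simp add: mult.assoc[symmetric] ennreal_mult)
      finally show "(\<integral>\<^sup>+x. indicator (B \<gamma> k) x \<partial>M) \<le> ennreal (c * \<gamma>) * ennreal (\<delta> k)" .
    qed
    also have "\<dots> = ennreal (c * \<gamma>) * ennreal s"
      by (simp add: nn_integral_cmult sumB)
    also have "\<dots> = ennreal (c * \<gamma> * s)"
      using that assms s by (simp add: ennreal_mult)
    finally show ?thesis .
  qed
  define N where "N = (\<Inter>m. \<Union>k\<in>I. B (inverse (real (Suc m))) k)"
  have N [measurable]: "N \<in> sets M"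
    unfolding N_def using I by (intro sets.countable_INT sets.countable_UN') auto
  have "measure M N \<le> c * inverse (real (Suc m)) * s" for m
  proof -
    have "emeasure M N \<le> emeasure M (\<Union>k\<in>I. B (inverse (real (Suc m))) k)"
      using I by (intro emeasure_mono sets.countable_UN') (auto simp: N_def)
    also have "\<dots> \<le> ennreal (c * inverse (real (Suc m)) * s)" by (rule U) simp
    finally show ?thesis
      using assms s by (simp add: emeasure_eq_measure)
  qed
  moreover have "(\<lambda>m. c * inverse (real (Suc m)) * s) \<longlonglongrightarrow> c * 0 * s"
    by (intro tendsto_intros LIMSEQ_inverse_real_of_nat)
  ultimately have "measure M N \<le> c * 0 * s"
    by (intro LIMSEQ_le_const) auto
  then have "emeasure M N = 0" by (simp add: emeasure_eq_measure measure_le_0_iff)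
  then have "AE x in M. x \<notin> N" using N by (intro AE_not_in) auto
  then show ?thesis
  proof (rule AE_mp, intro AE_I2 impI)
    fix x assume x: "x \<in> space M" "x \<notin> N"
    then obtain m where "x \<notin> (\<Union>k\<in>I. B (inverse (real (Suc m))) k)" by (auto simp: N_def)
    then have "\<forall>k\<in>I. \<forall>n :: int. inverse (real (Suc m)) * \<delta> k \<le> \<bar>f k x - of_int n\<bar>"
      using x by (auto simp: B_def not_less)
    then show "\<exists>\<gamma>>0. \<forall>k\<in>I. \<forall>n :: int. \<gamma> * \<delta> k \<le> \<bar>f k x - of_int n\<bar>"
      by (intro exI[of _ "inverse (real (Suc m))"]) auto
  qed
qed

section \<open>Fourier series on the infinite torus\<close>

text \<open>Encodes a sum over a countable index set as a sum over the naturals, padded with zeros, without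
  distinguishing finite from infinite index sets.\<close>

lemma has_sum_countable_iff_UNIV_nat:
  assumes "countable I"
  shows "(f has_sum s) I \<longleftrightarrow>
    ((\<lambda>n. if n \<in> to_nat_on I ` I then f (from_nat_into I n) else 0) has_sum s) UNIV"
proof -
  have "((\<lambda>n. if n \<in> to_nat_on I ` I then f (from_nat_into I n) else 0) has_sum s) UNIV
      \<longleftrightarrow> ((f \<circ> from_nat_into I) has_sum s) (to_nat_on I ` I)"
    by (rule has_sum_cong_neutral) auto
  also have "\<dots> \<longleftrightarrow> (((f \<circ> from_nat_into I) \<circ> to_nat_on I) has_sum s) I"
    by (rule has_sum_reindex) (rule inj_on_to_nat_on[OF assms])
  also have "\<dots> \<longleftrightarrow> (f has_sum s) I"
    by (rule has_sum_cong) (use assms in simp)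
  finally show ?thesis ..
qed

text \<open>Dominated exchange of an unconditional sum and an integral, by transfer to ordinary series.\<close>

lemma has_sum_integral:
  fixes f :: "'k \<Rightarrow> 'a \<Rightarrow> complex"
  assumes I: "countable I" and int: "\<And>k. k \<in> I \<Longrightarrow> integrable M (f k)" and h: "integrable M h"
    and bound: "\<And>k x. k \<in> I \<Longrightarrow> x \<in> space M \<Longrightarrow> norm (f k x) \<le> b k * h x"
    and b: "\<And>k. k \<in> I \<Longrightarrow> 0 \<le> b k" "b summable_on I"
    and g: "\<And>x. x \<in> space M \<Longrightarrow> ((\<lambda>k. f k x) has_sum g x) I"
  shows "((\<lambda>k. \<integral>x. f k x \<partial>M) has_sum (\<integral>x. g x \<partial>M)) I"
proof -
  define J where "J = to_nat_on I ` I"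
  define e where "e = from_nat_into I"
  have e: "e n \<in> I" if "n \<in> J" for n
    using that I by (auto simp: J_def e_def)
  define F where "F n x = (if n \<in> J then f (e n) x else 0)" for n x
  define B where "B n = (if n \<in> J then b (e n) else 0)" for n
  have nat: "(u has_sum s) I \<longleftrightarrow> ((\<lambda>n. if n \<in> J then u (e n) else 0) has_sum s) UNIV"
    for u :: "'k \<Rightarrow> 'b :: {comm_monoid_add, topological_space}" and s
    unfolding J_def e_def by (rule has_sum_countable_iff_UNIV_nat[OF I])
  have B: "summable B"
    using b(2) unfolding summable_on_def nat B_def[symmetric]
    by (auto dest: has_sum_imp_sums sums_summable)
  have F_int: "integrable M (F n)" for n
    unfolding F_def using int[OF e, of n] by (cases "n \<in> J") auto
  have F_le: "norm (F n x) \<le> B n * h x" if "x \<in> space M" for n x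
    using bound[OF e that, of n] by (auto simp: F_def B_def)
  have F_sum: "((\<lambda>n. F n x) has_sum g x) UNIV" if "x \<in> space M" for x
    using g[OF that] unfolding nat F_def .
  have summ: "summable (\<lambda>n. \<integral>x. norm (F n x) \<partial>M)"
  proof (rule summable_comparison_test')
    show "summable (\<lambda>n. B n * (\<integral>x. h x \<partial>M))" by (intro summable_mult2 B)
    fix n :: nat
    have "(\<integral>x. norm (F n x) \<partial>M) \<le> (\<integral>x. B n * h x \<partial>M)"
      using F_int h F_le by (intro integral_mono integrable_mult_right) auto
    then show "norm (\<integral>x. norm (F n x) \<partial>M) \<le> B n * (\<integral>x. h x \<partial>M)" by simp
  qed
  have ae: "AE x in M. summable (\<lambda>n. norm (F n x))"
  proof (rule AE_I2)
    fix x assume "x \<in> space M"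
    then show "summable (\<lambda>n. norm (F n x))"
      by (intro summable_comparison_test'[OF summable_mult2[OF B, of "h x"], of 0])
         (simp add: F_le)
  qed
  have "(\<lambda>n. \<integral>x. F n x \<partial>M) sums (\<integral>x. (\<Sum>n. F n x) \<partial>M)"
    by (rule sums_integral[OF F_int ae summ])
  also have "(\<integral>x. (\<Sum>n. F n x) \<partial>M) = (\<integral>x. g x \<partial>M)"
    by (intro Bochner_Integration.integral_cong refl sums_unique[symmetric] has_sum_imp_sums F_sum)
  finally have "(\<lambda>n. \<integral>x. F n x \<partial>M) sums (\<integral>x. g x \<partial>M)" .
  moreover have "summable (\<lambda>n. norm (\<integral>x. F n x \<partial>M))"
    by (rule summable_comparison_test'[OF summ, of 0]) simp
  ultimately have "((\<lambda>n. \<integral>x. F n x \<partial>M) has_sum (\<integral>x. g x \<partial>M)) UNIV"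
    by (rule norm_summable_imp_has_sum[rotated])
  also have "(\<lambda>n. \<integral>x. F n x \<partial>M) = (\<lambda>n. if n \<in> J then \<integral>x. f (e n) x \<partial>M else 0)"
    by (auto simp: F_def fun_eq_iff)
  finally show ?thesis by (simp only: nat)
qed

lemma integral_PiM_eq_0_fibrewise:
  fixes f :: "('i \<Rightarrow> 'a) \<Rightarrow> complex"
  assumes M: "\<And>i. i \<in> I \<Longrightarrow> prob_space (M i)" and j: "j \<in> I"
    and f [measurable]: "f \<in> borel_measurable (PiM I M)" and bound: "\<And>x. norm (f x) \<le> B"
    and fibre: "\<And>X. X \<in> space (PiM I M) \<Longrightarrow> (\<integral>x. f (X(j := x)) \<partial>M j) = 0"
  shows "(\<integral>X. f X \<partial>PiM I M) = 0"
proof -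
  interpret Q: prob_space "PiM I M" by (rule prob_space_PiM) (rule M)
  interpret Mj: prob_space "M j" by (rule M[OF j])
  interpret pair_prob_space "M j" "PiM I M" ..
  let ?r = "\<lambda>(x, X). X(j := x)"
  have eq: "distr (M j \<Otimes>\<^sub>M PiM I M) (PiM I M) ?r = PiM I M"
    using distr_pair_PiM_eq_PiM[of I M j] M j by (simp add: insert_absorb)
  have r [measurable]: "?r \<in> M j \<Otimes>\<^sub>M PiM I M \<rightarrow>\<^sub>M PiM I M"
    unfolding split_beta using j by (intro measurable_fun_upd[where J = I]) auto
  have int: "integrable (M j \<Otimes>\<^sub>M PiM I M) (\<lambda>(x, X). f (X(j := x)))"
  proof (rule P.integrable_const_bound[of _ B])
    show "(\<lambda>(x, X). f (X(j := x))) \<in> borel_measurable (M j \<Otimes>\<^sub>M PiM I M)"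
      using measurable_compose[OF r f] by (simp add: split_beta)
  qed (auto simp: bound)
  have "(\<integral>X. f X \<partial>PiM I M) = (\<integral>X. f X \<partial>distr (M j \<Otimes>\<^sub>M PiM I M) (PiM I M) ?r)"
    by (simp only: eq)
  also have "\<dots> = (\<integral>p. f (?r p) \<partial>(M j \<Otimes>\<^sub>M PiM I M))"
    by (rule integral_distr[OF r f])
  also have "\<dots> = (\<integral>X. (\<integral>x. f (X(j := x)) \<partial>M j) \<partial>PiM I M)"
    using integral_snd[OF int] by (simp add: case_prod_unfold)
  also have "\<dots> = (\<integral>X. 0 \<partial>PiM I M)"
    by (intro Bochner_Integration.integral_cong refl fibre)
  finally show ?thesis by simp
qed

lemma integral_circle_exp_eq_0:
  assumes "p \<noteq> 0"
  shows "(\<integral>x. circle_exp (of_int p * x + c) \<partial>restrict_space lborel {0..<1}) = 0"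
proof -
  define z where "z = 2 * of_real pi * \<i> * (of_int p :: complex)"
  have z: "z \<noteq> 0" using assms by (simp add: z_def)
  have e: "circle_exp (of_int p * x) = exp (z * of_real x)" for x
    by (simp add: circle_exp_def z_def cis_conv_exp mult_ac)
  have d: "((\<lambda>x. exp (z * of_real x) / z) has_vector_derivative circle_exp (of_int p * x)) (at x within A)"
    for x A
    unfolding e by (rule has_vector_derivative_real_field) (auto intro!: derivative_eq_intros simp: z)
  have "((\<lambda>x. circle_exp (of_int p * x)) has_integral
      exp (z * of_real 1) / z - exp (z * of_real 0) / z) {0..1}"
    by (rule fundamental_theorem_of_calculus) (auto intro: d)
  moreover have "exp (z * of_real 1) = 1"
    using circle_exp_int[of p] e[of 1] by simp
  ultimately have "((\<lambda>x. circle_exp (of_int p * x)) has_integral 0) {0..1}" by simp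
  also have "?this \<longleftrightarrow> ((\<lambda>x. circle_exp (of_int p * x)) has_integral 0) {0..<1}"
  proof (rule has_integral_spike_set_eq)
    show "negligible {x \<in> {0..1} - {0..<1}. circle_exp (of_int p * x) \<noteq> 0}"
      by (rule negligible_subset[of "{1}"]) auto
    show "negligible {x \<in> {0..<1} - {0..1}. circle_exp (of_int p * x) \<noteq> 0}"
      by (rule negligible_subset[of "{}"]) auto
  qed
  finally have hk: "((\<lambda>x. circle_exp (of_int p * x)) has_integral 0) {0..<1}" .
  have si: "set_integrable lborel {0..<1} (\<lambda>x. circle_exp (of_int p * x))"
  proof (rule set_integrable_bound)
    show "set_integrable lborel {0..<1} (\<lambda>x :: real. 1 :: real)"
      by (simp add: set_integrable_def)
  qed (auto simp: set_borel_measurable_def)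
  have "(\<integral>x. circle_exp (of_int p * x + c) \<partial>restrict_space lborel {0..<1})
      = (LBINT x:{0..<1}. circle_exp (of_int p * x) * circle_exp c)"
    unfolding set_lebesgue_integral_def circle_exp_add by (rule integral_restrict_space) simp
  also have "\<dots> = (LBINT x:{0..<1}. circle_exp (of_int p * x)) * circle_exp c"
    by (rule set_integral_mult_left)
  also have "(LBINT x:{0..<1}. circle_exp (of_int p * x)) = 0"
    using set_borel_integral_eq_integral(2)[OF si] integral_unique[OF hk] by simp
  finally show ?thesis by simp
qed

text \<open>Integrating over a single coordinate with nonzero frequency already gives zero.\<close>

lemma integral_torus_circle_exp:
  assumes k: "k \<in> freqs \<eta>" "k \<noteq> (\<lambda>_. 0)"
  shows "(\<integral>\<theta>. circle_exp (freq_inner k \<theta>) \<partial>torus_measure) = 0"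
proof -
  obtain j where j: "k j \<noteq> 0" using k(2) by auto
  have m: "(\<lambda>\<theta>. circle_exp (freq_inner k \<theta>)) \<in> borel_measurable torus_measure"
    by measurable
  show ?thesis
    unfolding torus_measure_def
  proof (rule integral_PiM_eq_0_fibrewise[of _ _ j _ 1])
    show "(\<lambda>\<theta>. circle_exp (freq_inner k \<theta>)) \<in> borel_measurable (\<Pi>\<^sub>M j\<in>UNIV. restrict_space lborel {0..<1})"
      using m by (simp add: torus_measure_def)
    show "(\<integral>x. circle_exp (freq_inner k (X(j := x))) \<partial>restrict_space lborel {0..<1}) = 0" for X
      unfolding freq_inner_upd[where k = k and x = X, OF finite_support[OF k(1)] j] by (rule integral_circle_exp_eq_0[OF j])
  qed (auto intro!: prob_spaceI simp: space_restrict_space emeasure_restrict_space)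
qed

text \<open>The expansion restricted to the real torus; what analyticity gives survives in the exponential weight on
  the coefficients.\<close>

definition fourier_coeffs :: "nat \<Rightarrow> real \<Rightarrow> ((nat \<Rightarrow> complex) \<Rightarrow> complex) \<Rightarrow> ((nat \<Rightarrow> int) \<Rightarrow> complex) \<Rightarrow> bool" where
  "fourier_coeffs \<eta> \<sigma> u c \<longleftrightarrow>
     (\<lambda>k. norm (c k) * exp (2 * pi * \<sigma> * freq_norm \<eta> k)) summable_on freqs \<eta> \<and>
     (\<forall>\<theta>\<in>torus. ((\<lambda>k. c k * circle_exp (freq_inner k \<theta>)) has_sum on_torus u \<theta>) (freqs \<eta>))"

lemma analytic_function_fourier_coeffs:
  assumes "u \<in> analytic_functions \<eta> \<sigma>" "0 < \<sigma>"
  obtains c where "fourier_coeffs \<eta> \<sigma> u c"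
proof -
  obtain c where c: "(\<lambda>k. norm (c k) * exp (2 * pi * \<sigma> * freq_norm \<eta> k)) summable_on freqs \<eta>"
    "\<And>\<theta>. \<theta> \<in> thick_torus \<eta> \<sigma> \<Longrightarrow>
      ((\<lambda>k. c k * exp (2 * of_real pi * \<i> * freq_dot k \<theta>)) has_sum u \<theta>) (freqs \<eta>)"
    using assms(1) by (auto simp: analytic_functions_def)
  have "((\<lambda>k. c k * circle_exp (freq_inner k \<theta>)) has_sum on_torus u \<theta>) (freqs \<eta>)"
    if "\<theta> \<in> torus" for \<theta>
  proof -
    have "0 \<le> jap j ^ \<eta>" for j using one_le_jap[of j] by (intro zero_le_power) linarith
    then have "(\<lambda>j. complex_of_real (\<theta> j)) \<in> thick_torus \<eta> \<sigma>"
      using that assms(2) by (auto simp: thick_torus_def torus_def)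
    from c(2)[OF this] show ?thesis
      unfolding on_torus_def
      by (rule has_sum_cong[THEN iffD1, rotated])
         (simp add: freq_dot_of_real circle_exp_def cis_conv_exp mult_ac)
  qed
  with c(1) show ?thesis by (intro that[of c]) (simp add: fourier_coeffs_def)
qed

lemma fourier_coeffs_norm_summable:
  assumes "fourier_coeffs \<eta> \<sigma> u c" "0 < \<sigma>"
  shows "(\<lambda>k. norm (c k)) summable_on freqs \<eta>"
proof (rule summable_on_comparison_test)
  show "(\<lambda>k. norm (c k) * exp (2 * pi * \<sigma> * freq_norm \<eta> k)) summable_on freqs \<eta>"
    using assms by (simp add: fourier_coeffs_def)
  fix k assume "k \<in> freqs \<eta>"
  then have "1 \<le> exp (2 * pi * \<sigma> * freq_norm \<eta> k)"
    using assms freq_norm_nonneg by simp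
  then show "norm (c k) \<le> norm (c k) * exp (2 * pi * \<sigma> * freq_norm \<eta> k)"
    by (simp add: mult_le_cancel_left1)
qed simp

lemma integral_on_torus:
  assumes c: "fourier_coeffs \<eta> \<sigma> u c" and "0 < \<sigma>"
  shows "(\<integral>\<theta>. on_torus u \<theta> \<partial>torus_measure) = c (\<lambda>_. 0)"
proof -
  interpret prob_space torus_measure by (rule prob_space_torus_measure)
  have "((\<lambda>k. \<integral>\<theta>. c k * circle_exp (freq_inner k \<theta>) \<partial>torus_measure) has_sum
      (\<integral>\<theta>. on_torus u \<theta> \<partial>torus_measure)) (freqs \<eta>)"
  proof (rule has_sum_integral[where h = "\<lambda>_. 1" and b = "\<lambda>k. norm (c k)"])
    show "integrable torus_measure (\<lambda>\<theta>. c k * circle_exp (freq_inner k \<theta>))" for k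
      by (rule integrable_const_bound[where B = "norm (c k)"]) (auto simp: norm_mult)
    show "((\<lambda>k. c k * circle_exp (freq_inner k \<theta>)) has_sum on_torus u \<theta>) (freqs \<eta>)"
      if "\<theta> \<in> space torus_measure" for \<theta>
      using c that by (simp add: fourier_coeffs_def space_torus_measure)
  qed (use fourier_coeffs_norm_summable[OF assms] in \<open>auto simp: countable_freqs norm_mult\<close>)
  moreover have "((\<lambda>k. \<integral>\<theta>. c k * circle_exp (freq_inner k \<theta>) \<partial>torus_measure) has_sum c (\<lambda>_. 0)) (freqs \<eta>)"
  proof (rule has_sum_finite_neutralI[of "{\<lambda>_. 0}"])
    show "(\<integral>\<theta>. c k * circle_exp (freq_inner k \<theta>) \<partial>torus_measure) = 0"
      if "k \<in> freqs \<eta> - {\<lambda>_. 0}" for k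
      using integral_torus_circle_exp[of k \<eta>] that by simp
    show "c (\<lambda>_. 0) = (\<Sum>k\<in>{\<lambda>_. 0}. \<integral>\<theta>. c k * circle_exp (freq_inner k \<theta>) \<partial>torus_measure)"
      by (simp add: freq_inner_def prob_space)
  qed (auto simp: zero_in_freqs)
  ultimately show ?thesis by (rule has_sum_unique)
qed

text \<open>The fractional parts in \<open>rotate_by\<close> change the pairing with an integer vector by an integer only.\<close>

lemma circle_exp_freq_inner_rotate:
  "circle_exp (freq_inner k (rotate_by \<rho> s \<theta>)) = circle_exp (freq_inner k \<theta>) * circle_exp (freq_inner k \<rho> * s)"
proof -
  have "freq_inner k (rotate_by \<rho> s \<theta>)
      = freq_inner k \<theta> + freq_inner k \<rho> * s + of_int (- (\<Sum>j | k j \<noteq> 0. k j * \<lfloor>\<theta> j + s * \<rho> j\<rfloor>))"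
    unfolding freq_inner_def rotate_by_def frac_def
    by (simp add: algebra_simps sum.distrib sum_subtractf sum_distrib_left sum_distrib_right)
  then show ?thesis by (simp only: circle_exp_add circle_exp_int mult_1_right)
qed

lemma rotate_by_in_torus: "rotate_by \<rho> s \<theta> \<in> torus"
  by (simp add: rotate_by_def torus_def frac_lt_1)

lemma summable_on_prod_PiE:
  fixes f :: "'i \<Rightarrow> 'k \<Rightarrow> real"
  assumes "finite A" "\<And>i. i \<in> A \<Longrightarrow> countable (B i)"
    and "\<And>i. i \<in> A \<Longrightarrow> f i summable_on B i" "\<And>i k. i \<in> A \<Longrightarrow> k \<in> B i \<Longrightarrow> 0 \<le> f i k"
  shows "(\<lambda>g. \<Prod>i\<in>A. f i (g i)) summable_on PiE A B"
proof -
  have "Infinite_Set_Sum.abs_summable_on (f i) (B i)" if "i \<in> A" for i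
    unfolding abs_summable_equivalent[symmetric]
    using assms(3)[OF that] assms(4)[OF that] by (simp cong: summable_on_cong)
  then have "Infinite_Set_Sum.abs_summable_on (\<lambda>g. \<Prod>i\<in>A. f i (g i)) (PiE A B)"
    using assms by (intro abs_summable_on_prod_PiE) auto
  then have "(\<lambda>g. norm (\<Prod>i\<in>A. f i (g i))) summable_on PiE A B"
    by (simp only: abs_summable_equivalent[symmetric])
  also have "?this \<longleftrightarrow> ?thesis"
    using assms(4) by (intro summable_on_cong) (auto intro!: abs_of_nonneg prod_nonneg simp: PiE_iff)
  finally show ?thesis .
qed

section \<open>Orbit averages as sums over frequency tuples\<close>

definition tuple_coeff :: "nat \<Rightarrow> (nat \<Rightarrow> (nat \<Rightarrow> int) \<Rightarrow> complex) \<Rightarrow> (nat \<Rightarrow> nat \<Rightarrow> int) \<Rightarrow> complex" where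
  "tuple_coeff l c g = (\<Prod>i=1..l. c i (g i))"

definition tuple_phase :: "nat \<Rightarrow> (nat \<Rightarrow> nat \<Rightarrow> int) \<Rightarrow> (nat \<Rightarrow> real) \<Rightarrow> complex" where
  "tuple_phase l g \<theta> = (\<Prod>i=1..l. circle_exp (freq_inner (g i) \<theta>))"

abbreviation tuples :: "nat \<Rightarrow> nat \<Rightarrow> (nat \<Rightarrow> nat \<Rightarrow> int) set" where
  "tuples l \<eta> \<equiv> PiE {1..l} (\<lambda>_. freqs \<eta>)"

lemma norm_tuple_phase [simp]: "norm (tuple_phase l g \<theta>) = 1"
  by (simp add: tuple_phase_def prod_norm[symmetric])

lemma circle_exp_sum: "circle_exp (\<Sum>i\<in>A. f i) = (\<Prod>i\<in>A. circle_exp (f i))"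
  by (induction A rule: infinite_finite_induct) (simp_all add: circle_exp_add)

lemma countable_tuples: "countable (tuples l \<eta>)"
  by (intro countable_PiE countable_freqs) auto

lemma tuple_coeff_summable:
  assumes "\<And>i. i \<in> {1..l} \<Longrightarrow> fourier_coeffs \<eta> \<sigma> (F i) (c i)" "0 < \<sigma>"
  shows "(\<lambda>g. norm (tuple_coeff l c g)) summable_on tuples l \<eta>"
  unfolding tuple_coeff_def prod_norm[symmetric]
  using fourier_coeffs_norm_summable[OF assms]
  by (intro summable_on_prod_PiE countable_freqs) auto

text \<open>Absolute summability allows the product of the \<open>l\<close> Fourier series to be multiplied out.\<close>

lemma orbit_product_has_sum:
  assumes c: "\<And>i. i \<in> {1..l} \<Longrightarrow> fourier_coeffs \<eta> \<sigma> (F i) (c i)" and "0 < \<sigma>"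
  shows "((\<lambda>g. tuple_coeff l c g * tuple_phase l g \<theta> * circle_exp (tuple_inner l g \<rho> * s))
    has_sum orbit_product l F \<rho> s \<theta>) (tuples l \<eta>)"
proof -
  define f where "f i k = c i k * circle_exp (freq_inner k (rotate_by (\<rho> i) s \<theta>))" for i k
  have f_sum: "(f i has_sum on_torus (F i) (rotate_by (\<rho> i) s \<theta>)) (freqs \<eta>)" if "i \<in> {1..l}" for i
    using c[OF that] rotate_by_in_torus unfolding f_def fourier_coeffs_def by blast
  have f_prod: "(\<Prod>i=1..l. f i (g i))
      = tuple_coeff l c g * tuple_phase l g \<theta> * circle_exp (tuple_inner l g \<rho> * s)" for g
    by (simp add: f_def tuple_coeff_def tuple_phase_def tuple_inner_def circle_exp_freq_inner_rotate
        circle_exp_sum prod.distrib sum_distrib_right)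
  have abs: "(\<lambda>k. norm (f i k)) summable_on freqs \<eta>" if "i \<in> {1..l}" for i
    using fourier_coeffs_norm_summable[OF c[OF that] assms(2)] by (simp add: f_def norm_mult)
  have "(\<lambda>g. norm (\<Prod>i=1..l. f i (g i))) summable_on tuples l \<eta>"
    unfolding prod_norm[symmetric] using abs by (intro summable_on_prod_PiE countable_freqs) auto
  then have "(\<lambda>g. \<Prod>i=1..l. f i (g i)) summable_on tuples l \<eta>"
    by (rule abs_summable_summable)
  then have "((\<lambda>g. \<Prod>i=1..l. f i (g i)) has_sum infsum (\<lambda>g. \<Prod>i=1..l. f i (g i)) (tuples l \<eta>)) (tuples l \<eta>)"
    by (rule has_sum_infsum)
  also have "infsum (\<lambda>g. \<Prod>i=1..l. f i (g i)) (tuples l \<eta>) = (\<Prod>i=1..l. infsum (f i) (freqs \<eta>))"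
    by (rule infsum_prod_PiE_abs) (use abs in auto)
  also have "\<dots> = orbit_product l F \<rho> s \<theta>"
    unfolding orbit_product_def by (intro prod.cong infsumI f_sum) auto
  finally show ?thesis by (simp only: f_prod)
qed

lemma has_sum_finite_sum:
  fixes f :: "'n \<Rightarrow> 'k \<Rightarrow> complex"
  assumes "finite A" "\<And>n. n \<in> A \<Longrightarrow> (f n has_sum s n) I"
  shows "((\<lambda>k. \<Sum>n\<in>A. f n k) has_sum (\<Sum>n\<in>A. s n)) I"
  using assms by (induction A rule: finite_induct) (auto intro!: has_sum_add)

lemma DMW_has_sum:
  assumes c: "\<And>i. i \<in> {1..l} \<Longrightarrow> fourier_coeffs \<eta> \<sigma> (F i) (c i)" and "0 < \<sigma>"
  shows "((\<lambda>g. tuple_coeff l c g * tuple_phase l g \<theta> * discrete_mean N (tuple_inner l g \<rho>))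
    has_sum DMW l F \<rho> N \<theta>) (tuples l \<eta>)"
proof -
  let ?w = "\<lambda>n. complex_of_real (bump_weight (real n / real N))"
  let ?A = "complex_of_real (\<Sum>s<N. bump_weight (real s / real N))"
  have "((\<lambda>g. (\<Sum>n<N. ?w n * (tuple_coeff l c g * tuple_phase l g \<theta>
        * circle_exp (tuple_inner l g \<rho> * real n))) / ?A) has_sum DMW l F \<rho> N \<theta>) (tuples l \<eta>)"
    unfolding DMW_def
    by (intro has_sum_divide_const has_sum_finite_sum has_sum_cmult_right orbit_product_has_sum[OF c assms(2)]) auto
  also have "(\<lambda>g. (\<Sum>n<N. ?w n * (tuple_coeff l c g * tuple_phase l g \<theta>
        * circle_exp (tuple_inner l g \<rho> * real n))) / ?A)
      = (\<lambda>g. tuple_coeff l c g * tuple_phase l g \<theta> * discrete_mean N (tuple_inner l g \<rho>))"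
    by (simp add: discrete_mean_def sum_distrib_left mult_ac fun_eq_iff)
  finally show ?thesis .
qed

lemma bump_weight_measurable [measurable]: "bump_weight \<in> borel_measurable borel"
  unfolding bump_weight_eq [abs_def] by measurable

lemma CMW_has_sum:
  assumes c: "\<And>i. i \<in> {1..l} \<Longrightarrow> fourier_coeffs \<eta> \<sigma> (F i) (c i)" and "0 < \<sigma>"
  shows "((\<lambda>g. tuple_coeff l c g * tuple_phase l g \<theta> * continuous_mean T (tuple_inner l g \<rho>))
    has_sum CMW l F \<rho> T \<theta>) (tuples l \<eta>)"
proof -
  define B where "B = bump_bound 0 / bump_mass"
  have B: "norm (bump_weight x) \<le> B" for x
    using abs_bump_deriv_le[of 0 x] bump_mass_pos
    by (simp add: B_def bump_weight_eq divide_right_mono abs_divide)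
  define f where "f g s = indicator {0..T} s *\<^sub>R (of_real (bump_weight (s / T))
      * (tuple_coeff l c g * tuple_phase l g \<theta> * circle_exp (tuple_inner l g \<rho> * s)))" for g s
  have le: "norm (f g s) \<le> norm (tuple_coeff l c g) * (indicator {0..T} s * B)" for g s
    using mult_left_mono[OF B[of "s / T"], of "norm (tuple_coeff l c g)"]
    by (auto simp: f_def norm_mult indicator_def mult.commute)
  have meas: "f g \<in> borel_measurable borel" for g
    unfolding f_def by measurable
  have hint: "integrable lborel (\<lambda>s :: real. indicator {0..T} s * B)"
    by (intro integrable_mult_left integrable_real_indicator) (auto simp: emeasure_lborel_Icc_eq)
  have "((\<lambda>g. LBINT s. f g s) has_sum
      (LBINT s. indicator {0..T} s *\<^sub>R (of_real (bump_weight (s / T)) * orbit_product l F \<rho> s \<theta>))) (tuples l \<eta>)"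
  proof (rule has_sum_integral[where h = "\<lambda>s. indicator {0..T} s * B" and b = "\<lambda>g. norm (tuple_coeff l c g)"])
    show "integrable lborel (f g)" for g
    proof (rule Bochner_Integration.integrable_bound)
      show "integrable lborel (\<lambda>s. norm (tuple_coeff l c g) * (indicator {0..T} s * B))"
        by (intro integrable_mult_right hint)
      show "f g \<in> borel_measurable lborel" using meas by simp
      show "AE s in lborel. norm (f g s) \<le> norm (norm (tuple_coeff l c g) * (indicator {0..T} s * B))"
        using le order.trans[OF le abs_ge_self] by (intro AE_I2) simp
    qed
    show "((\<lambda>g. f g s) has_sum indicator {0..T} s *\<^sub>R (of_real (bump_weight (s / T)) * orbit_product l F \<rho> s \<theta>))
        (tuples l \<eta>)" for s
      unfolding f_def scaleR_conv_of_real
      by (intro has_sum_cmult_right orbit_product_has_sum[OF c assms(2)])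
    show "(\<lambda>g. norm (tuple_coeff l c g)) summable_on tuples l \<eta>"
      by (rule tuple_coeff_summable[OF c assms(2)])
    show "countable (tuples l \<eta>)" by (rule countable_tuples)
    show "integrable lborel (\<lambda>s. indicator {0..T} s * B)" by (rule hint)
  qed (use le in auto)
  then have "((\<lambda>g. (LBINT s. f g s) / of_real T) has_sum CMW l F \<rho> T \<theta>) (tuples l \<eta>)"
    unfolding CMW_def set_lebesgue_integral_def by (rule has_sum_divide_const)
  also have "(\<lambda>g. (LBINT s. f g s) / of_real T)
      = (\<lambda>g. tuple_coeff l c g * tuple_phase l g \<theta> * continuous_mean T (tuple_inner l g \<rho>))"
  proof
    fix g
    have "(LBINT s. f g s) = (LBINT s. (tuple_coeff l c g * tuple_phase l g \<theta>) *
        (indicator {0..T} s *\<^sub>R (of_real (bump_weight (s / T)) * circle_exp (tuple_inner l g \<rho> * s))))"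
      by (intro Bochner_Integration.integral_cong) (auto simp: f_def scaleR_conv_of_real mult_ac)
    also have "\<dots> = (tuple_coeff l c g * tuple_phase l g \<theta>) *
        (LBINT s:{0..T}. of_real (bump_weight (s / T)) * circle_exp (tuple_inner l g \<rho> * s))"
      unfolding set_lebesgue_integral_def by (rule integral_mult_right_zero)
    finally show "(LBINT s. f g s) / of_real T
        = tuple_coeff l c g * tuple_phase l g \<theta> * continuous_mean T (tuple_inner l g \<rho>)"
      by (simp add: continuous_mean_def)
  qed
  finally show ?thesis .
qed

lemma has_sum_remove:
  fixes f :: "'k \<Rightarrow> complex"
  assumes "(f has_sum s) I" "a \<in> I"
  shows "(f has_sum (s - f a)) (I - {a})"
proof -
  have "f summable_on (I - {a})"
    using assms(1) by (meson Diff_subset has_sum_imp_summable summable_on_subset_banach)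
  then obtain t where t: "(f has_sum t) (I - {a})" by (auto simp: summable_on_def)
  then have "(f has_sum (f a + t)) (insert a (I - {a}))" by (intro has_sum_insert) auto
  then have "s = f a + t"
    using assms by (simp add: insert_absorb has_sum_unique)
  with t show ?thesis by simp
qed

text \<open>The restriction to \<open>{1..l}\<close> makes this an element of the extensional function space \<open>tuples l \<eta>\<close>.\<close>

definition zero_tuple :: "nat \<Rightarrow> nat \<Rightarrow> nat \<Rightarrow> int" where
  "zero_tuple l = (\<lambda>i\<in>{1..l}. \<lambda>_. 0)"

lemma zero_tuple_in: "zero_tuple l \<in> tuples l \<eta>"
  by (auto simp: zero_tuple_def zero_in_freqs)

lemma zero_tuple_simps:
  "tuple_coeff l c (zero_tuple l) = (\<Prod>i=1..l. c i (\<lambda>_. 0))"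
  "tuple_phase l (zero_tuple l) \<theta> = 1" "tuple_inner l (zero_tuple l) \<rho> = 0"
  by (simp_all add: tuple_coeff_def tuple_phase_def tuple_inner_def zero_tuple_def freq_inner_def)

lemma nonzero_tuple:
  assumes "g \<in> tuples l \<eta> - {zero_tuple l}"
  obtains i where "i \<in> {1..l}" "g i \<in> freqs \<eta>" "g i \<noteq> (\<lambda>_. 0)"
proof -
  have "\<exists>i\<in>{1..l}. g i \<noteq> zero_tuple l i"
    using PiE_ext[of g "{1..l}" "\<lambda>_. freqs \<eta>" "zero_tuple l"] assms zero_tuple_in[of l \<eta>] by blast
  then show thesis using assms that by (auto simp: zero_tuple_def PiE_iff)
qed

definition tuple_norm :: "nat \<Rightarrow> nat \<Rightarrow> (nat \<Rightarrow> nat \<Rightarrow> int) \<Rightarrow> real" where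
  "tuple_norm l \<eta> g = (\<Sum>i=1..l. freq_norm \<eta> (g i))"

lemma tuple_norm_nonneg: "g \<in> tuples l \<eta> \<Longrightarrow> 0 \<le> tuple_norm l \<eta> g"
  unfolding tuple_norm_def by (intro sum_nonneg freq_norm_nonneg) (auto simp: PiE_iff)

text \<open>The thresholds of a tuple are the products of those of its entries. The square roots of the norms of the
  \<open>l\<close> entries add up to at most \<open>l\<close> times the square root of the total norm.\<close>

lemma AE_nonresonant:
  assumes "2 \<le> \<eta>"
  shows "\<exists>B>0. AE \<rho> in (\<Pi>\<^sub>M i\<in>{1..l}. rotation_measure). \<exists>\<gamma>>0. \<forall>g\<in>tuples l \<eta> - {zero_tuple l}. \<forall>n :: int.
    \<gamma> * exp (- (B * sqrt (tuple_norm l \<eta> g))) \<le> \<bar>tuple_inner l g \<rho> - of_int n\<bar>"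
proof -
  obtain B where B: "0 < B" "\<And>k. k \<in> freqs \<eta> \<Longrightarrow> exp (- (B * sqrt (freq_norm \<eta> k))) \<le> freq_weight k"
    using freq_weight_lower_bound[OF assms] by blast
  \<comment> \<open>The summand 1 only serves to keep the constant positive.\<close>
  define B' where "B' = B * real l + 1"
  have B': "0 < B'" using B by (simp add: B'_def add_nonneg_pos)
  define \<delta> where "\<delta> g = (\<Prod>i=1..l. freq_weight (g i))" for g :: "nat \<Rightarrow> nat \<Rightarrow> int"
  have \<delta>_pos: "0 < \<delta> g" for g unfolding \<delta>_def by (intro prod_pos freq_weight_pos)
  have \<delta>_ge: "exp (- (B' * sqrt (tuple_norm l \<eta> g))) \<le> \<delta> g" if g: "g \<in> tuples l \<eta>" for g
  proof -
    have gi: "g i \<in> freqs \<eta>" if "i \<in> {1..l}" for i using g that by (auto simp: PiE_iff)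
    have "(\<Sum>i=1..l. sqrt (freq_norm \<eta> (g i))) \<le> (\<Sum>i=1..l. sqrt (tuple_norm l \<eta> g))"
    proof (intro sum_mono real_sqrt_le_mono)
      fix i assume "i \<in> {1..l}"
      then show "freq_norm \<eta> (g i) \<le> tuple_norm l \<eta> g"
        unfolding tuple_norm_def using gi
        by (intro member_le_sum[of i "{1..l}" "\<lambda>i. freq_norm \<eta> (g i)"] freq_norm_nonneg) auto
    qed
    also have "\<dots> = real l * sqrt (tuple_norm l \<eta> g)" by simp
    finally have "B * (\<Sum>i=1..l. sqrt (freq_norm \<eta> (g i))) \<le> B * (real l * sqrt (tuple_norm l \<eta> g))"
      using B by (intro mult_left_mono) auto
    also have "\<dots> \<le> B' * sqrt (tuple_norm l \<eta> g)"
      using tuple_norm_nonneg[OF g] by (simp add: B'_def algebra_simps)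
    finally have "exp (- (B' * sqrt (tuple_norm l \<eta> g)))
        \<le> exp (\<Sum>i=1..l. - (B * sqrt (freq_norm \<eta> (g i))))"
      by (simp add: sum_negf sum_distrib_left)
    also have "\<dots> = (\<Prod>i=1..l. exp (- (B * sqrt (freq_norm \<eta> (g i)))))"
      by (simp add: exp_sum)
    also have "\<dots> \<le> \<delta> g"
      unfolding \<delta>_def by (intro prod_mono conjI B(2)[OF gi]) auto
    finally show ?thesis .
  qed
  have "AE \<rho> in (\<Pi>\<^sub>M i\<in>{1..l}. rotation_measure). \<exists>\<gamma>>0. \<forall>g\<in>tuples l \<eta> - {zero_tuple l}. \<forall>n :: int.
    \<gamma> * \<delta> g \<le> \<bar>tuple_inner l g \<rho> - of_int n\<bar>"
  proof (rule AE_uniform_lower_bound_of_summable[where c = 6])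
    show "prob_space (\<Pi>\<^sub>M i\<in>{1..l}. rotation_measure)"
      by (intro prob_space_PiM prob_space_rotation_measure)
    show "countable (tuples l \<eta> - {zero_tuple l})"
      by (intro countable_Diff countable_tuples)
    have "\<delta> summable_on tuples l \<eta>"
      unfolding \<delta>_def [abs_def] using summable_on_freq_weight freq_weight_pos
      by (intro summable_on_prod_PiE countable_freqs) (auto intro: less_imp_le)
    then show "\<delta> summable_on tuples l \<eta> - {zero_tuple l}"
      by (rule summable_on_subset_banach) auto
    show "emeasure (\<Pi>\<^sub>M i\<in>{1..l}. rotation_measure)
        {\<rho> \<in> space (\<Pi>\<^sub>M i\<in>{1..l}. rotation_measure). \<exists>n :: int. \<bar>tuple_inner l g \<rho> - of_int n\<bar> < d}
        \<le> ennreal (6 * d)" if "g \<in> tuples l \<eta> - {zero_tuple l}" "0 \<le> d" for g d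
      using nonzero_tuple[OF that(1)] emeasure_tuple_near_integer_le[of _ l g d] finite_support that(2)
      by metis
    show "tuple_inner l g \<in> borel_measurable (\<Pi>\<^sub>M i\<in>{1..l}. rotation_measure)" for g
      by (rule tuple_inner_measurable)
  qed (simp_all add: \<delta>_pos)
  then have "AE \<rho> in (\<Pi>\<^sub>M i\<in>{1..l}. rotation_measure). \<exists>\<gamma>>0. \<forall>g\<in>tuples l \<eta> - {zero_tuple l}. \<forall>n :: int.
    \<gamma> * exp (- (B' * sqrt (tuple_norm l \<eta> g))) \<le> \<bar>tuple_inner l g \<rho> - of_int n\<bar>"
  proof (rule AE_mp, intro AE_I2 impI)
    fix \<rho> assume "\<exists>\<gamma>>0. \<forall>g\<in>tuples l \<eta> - {zero_tuple l}. \<forall>n :: int. \<gamma> * \<delta> g \<le> \<bar>tuple_inner l g \<rho> - of_int n\<bar>"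
    then obtain \<gamma> where \<gamma>: "0 < \<gamma>"
      "\<And>g n. g \<in> tuples l \<eta> - {zero_tuple l} \<Longrightarrow> \<gamma> * \<delta> g \<le> \<bar>tuple_inner l g \<rho> - of_int n\<bar>" by blast
    have "\<gamma> * exp (- (B' * sqrt (tuple_norm l \<eta> g))) \<le> \<bar>tuple_inner l g \<rho> - of_int n\<bar>"
      if g: "g \<in> tuples l \<eta> - {zero_tuple l}" for g and n :: int
    proof -
      have "\<gamma> * exp (- (B' * sqrt (tuple_norm l \<eta> g))) \<le> \<gamma> * \<delta> g"
        using g \<gamma>(1) by (intro mult_left_mono \<delta>_ge) auto
      also have "\<dots> \<le> \<bar>tuple_inner l g \<rho> - of_int n\<bar>" by (rule \<gamma>(2)[OF g])
      finally show ?thesis .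
    qed
    with \<gamma>(1) show "\<exists>\<gamma>>0. \<forall>g\<in>tuples l \<eta> - {zero_tuple l}. \<forall>n :: int.
        \<gamma> * exp (- (B' * sqrt (tuple_norm l \<eta> g))) \<le> \<bar>tuple_inner l g \<rho> - of_int n\<bar>" by blast
  qed
  with B' show ?thesis by blast
qed

text \<open>Removing the zero tuple, whose term equals the product of the integrals, leaves a sum to which
  \<open>weighted_fourier_tail\<close> applies, with the phases as \<open>u\<close>.\<close>

lemma nonresonant_average_error:
  assumes c: "\<And>i. i \<in> {1..l} \<Longrightarrow> fourier_coeffs \<eta> \<sigma> (F i) (c i)" and "0 < \<sigma>" "0 < B" "0 < \<gamma>" "0 \<le> K"
    and small: "\<And>g n. g \<in> tuples l \<eta> - {zero_tuple l} \<Longrightarrow>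
      \<gamma> * exp (- (B * sqrt (tuple_norm l \<eta> g))) \<le> \<bar>tuple_inner l g \<rho> - of_int n\<bar>"
  shows "\<exists>D. \<forall>\<^sub>F X in at_top. \<forall>W \<theta> s. bump_average K X W \<longrightarrow>
    ((\<lambda>g. tuple_coeff l c g * tuple_phase l g \<theta> * W (tuple_inner l g \<rho>)) has_sum s) (tuples l \<eta>) \<longrightarrow>
    norm (s - (\<Prod>i=1..l. \<integral>\<theta>'. on_torus (F i) \<theta>' \<partial>torus_measure)) \<le> D * exp (- (ln X powr (3 / 2)))"
proof -
  let ?I = "tuples l \<eta> - {zero_tuple l}"
  have "(\<lambda>g. norm (tuple_coeff l c g) * exp (2 * pi * \<sigma> * tuple_norm l \<eta> g)) summable_on tuples l \<eta>"
  proof -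
    have "(\<lambda>g. \<Prod>i=1..l. norm (c i (g i)) * exp (2 * pi * \<sigma> * freq_norm \<eta> (g i))) summable_on tuples l \<eta>"
      using c by (intro summable_on_prod_PiE countable_freqs) (auto simp: fourier_coeffs_def)
    then show ?thesis
      by (simp add: tuple_coeff_def tuple_norm_def prod_norm[symmetric] prod.distrib exp_sum sum_distrib_left)
  qed
  then have sm: "(\<lambda>g. norm (tuple_coeff l c g) * exp (2 * pi * \<sigma> * tuple_norm l \<eta> g)) summable_on ?I"
    by (rule summable_on_subset_banach) auto
  have \<tau>: "0 < 2 * pi * \<sigma>" using assms by simp
  have mean: "(\<Prod>i=1..l. \<integral>\<theta>'. on_torus (F i) \<theta>' \<partial>torus_measure) = tuple_coeff l c (zero_tuple l)"
    unfolding zero_tuple_simps by (intro prod.cong refl integral_on_torus[OF c assms(2)]) auto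
  have "\<exists>D. \<forall>\<^sub>F X in at_top. \<forall>W u s. bump_average K X W \<longrightarrow> (\<forall>g\<in>?I. norm (u g) \<le> 1) \<longrightarrow>
     ((\<lambda>g. tuple_coeff l c g * u g * W (tuple_inner l g \<rho>)) has_sum s) ?I \<longrightarrow>
     norm s \<le> D * exp (- (ln X powr (3 / 2)))"
    by (rule weighted_fourier_tail[OF sm \<tau> _ small assms(4,3,5)]) (rule tuple_norm_nonneg, erule DiffD1)
  then obtain D where D: "\<forall>\<^sub>F X in at_top. \<forall>W u s. bump_average K X W \<longrightarrow> (\<forall>g\<in>?I. norm (u g) \<le> 1) \<longrightarrow>
     ((\<lambda>g. tuple_coeff l c g * u g * W (tuple_inner l g \<rho>)) has_sum s) ?I \<longrightarrow>
     norm s \<le> D * exp (- (ln X powr (3 / 2)))" ..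
  show ?thesis
  proof (rule exI[of _ D], rule eventually_mono[OF D], intro allI impI)
    fix X W \<theta> s
    assume D: "\<forall>W u s. bump_average K X W \<longrightarrow> (\<forall>g\<in>?I. norm (u g) \<le> 1) \<longrightarrow>
        ((\<lambda>g. tuple_coeff l c g * u g * W (tuple_inner l g \<rho>)) has_sum s) ?I \<longrightarrow>
        norm s \<le> D * exp (- (ln X powr (3 / 2)))"
      and W: "bump_average K X W"
      and s: "((\<lambda>g. tuple_coeff l c g * tuple_phase l g \<theta> * W (tuple_inner l g \<rho>)) has_sum s) (tuples l \<eta>)"
    have "W 0 = 1" using W by (simp add: bump_average_def)
    then have "((\<lambda>g. tuple_coeff l c g * tuple_phase l g \<theta> * W (tuple_inner l g \<rho>)) has_sum
        (s - tuple_coeff l c (zero_tuple l))) ?I"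
      using has_sum_remove[OF s zero_tuple_in] by (simp add: zero_tuple_simps(2,3))
    moreover have "\<forall>g\<in>?I. norm (tuple_phase l g \<theta>) \<le> 1" by simp
    ultimately show "norm (s - (\<Prod>i=1..l. \<integral>\<theta>'. on_torus (F i) \<theta>' \<partial>torus_measure))
        \<le> D * exp (- (ln X powr (3 / 2)))"
      unfolding mean
      by (intro D[THEN spec[of _ W], THEN spec[of _ "\<lambda>g. tuple_phase l g \<theta>"], THEN spec, THEN mp, THEN mp, THEN mp] W)
  qed
qed

theorem theorem4p5:
  fixes l \<eta> :: nat and \<sigma> :: real
    and F :: "nat \<Rightarrow> (nat \<Rightarrow> complex) \<Rightarrow> complex"
  assumes "l \<ge> 1" and "\<eta> \<ge> 2" and "\<sigma> > 0"
    and "\<And>i. i \<in> {1..l} \<Longrightarrow> F i \<in> analytic_functions \<eta> \<sigma>"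
  shows "AE \<rho> in (\<Pi>\<^sub>M i\<in>{1..l}. rotation_measure). \<exists>\<zeta>\<^sub>3::real. \<zeta>\<^sub>3 > 1 \<and>
    (\<exists>C. \<forall>\<^sub>F N in sequentially. \<forall>\<theta>\<in>torus.
       norm (DMW l F \<rho> N \<theta> - (\<Prod>i=1..l. \<integral>\<theta>'. on_torus (F i) \<theta>' \<partial>torus_measure))
         \<le> C * exp (- (ln (real N) powr \<zeta>\<^sub>3))) \<and>
    (\<exists>C. \<forall>\<^sub>F T in at_top. \<forall>\<theta>\<in>torus.
       norm (CMW l F \<rho> T \<theta> - (\<Prod>i=1..l. \<integral>\<theta>'. on_torus (F i) \<theta>' \<partial>torus_measure))
         \<le> C * exp (- (ln T powr \<zeta>\<^sub>3)))"
proof -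
  have "\<forall>i\<in>{1..l}. \<exists>c. fourier_coeffs \<eta> \<sigma> (F i) c"
    using analytic_function_fourier_coeffs assms(3,4) by metis
  then obtain c where c: "\<And>i. i \<in> {1..l} \<Longrightarrow> fourier_coeffs \<eta> \<sigma> (F i) (c i)"
    by metis
  obtain B where B: "0 < B" and
    ae: "AE \<rho> in (\<Pi>\<^sub>M i\<in>{1..l}. rotation_measure). \<exists>\<gamma>>0. \<forall>g\<in>tuples l \<eta> - {zero_tuple l}. \<forall>n :: int.
      \<gamma> * exp (- (B * sqrt (tuple_norm l \<eta> g))) \<le> \<bar>tuple_inner l g \<rho> - of_int n\<bar>"
    using AE_nonresonant[OF assms(2)] by blast
  show ?thesis
    using ae
  proof (rule AE_mp, intro AE_I2 impI)
    fix \<rho> assume "\<exists>\<gamma>>0. \<forall>g\<in>tuples l \<eta> - {zero_tuple l}. \<forall>n :: int.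
      \<gamma> * exp (- (B * sqrt (tuple_norm l \<eta> g))) \<le> \<bar>tuple_inner l g \<rho> - of_int n\<bar>"
    then obtain \<gamma> where \<gamma>: "0 < \<gamma>" "\<And>g n. g \<in> tuples l \<eta> - {zero_tuple l} \<Longrightarrow>
      \<gamma> * exp (- (B * sqrt (tuple_norm l \<eta> g))) \<le> \<bar>tuple_inner l g \<rho> - of_int n\<bar>" by blast
    let ?m = "\<Prod>i=1..l. \<integral>\<theta>'. on_torus (F i) \<theta>' \<partial>torus_measure"
    have sum_D: "((\<lambda>g. tuple_coeff l c g * tuple_phase l g \<theta> * discrete_mean N (tuple_inner l g \<rho>))
        has_sum DMW l F \<rho> N \<theta>) (tuples l \<eta>)" for N \<theta>
      by (rule DMW_has_sum[OF c assms(3)])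
    have sum_C: "((\<lambda>g. tuple_coeff l c g * tuple_phase l g \<theta> * continuous_mean T (tuple_inner l g \<rho>))
        has_sum CMW l F \<rho> T \<theta>) (tuples l \<eta>)" for T \<theta>
      by (rule CMW_has_sum[OF c assms(3)])
    have error: "\<exists>D. \<forall>\<^sub>F X in at_top. \<forall>W \<theta> s. bump_average K X W \<longrightarrow>
        ((\<lambda>g. tuple_coeff l c g * tuple_phase l g \<theta> * W (tuple_inner l g \<rho>)) has_sum s) (tuples l \<eta>) \<longrightarrow>
        norm (s - ?m) \<le> D * exp (- (ln X powr (3 / 2)))" if "0 \<le> K" for K
      by (rule nonresonant_average_error[OF c assms(3) B \<gamma>(1) that \<gamma>(2)])
    have "\<exists>C. \<forall>\<^sub>F N in sequentially. \<forall>\<theta>\<in>torus.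
        norm (DMW l F \<rho> N \<theta> - ?m) \<le> C * exp (- (ln (real N) powr (3 / 2)))"
    proof -
      have "0 \<le> exp (6 :: real)" by simp
      from error[OF this]
      obtain D where D: "\<forall>\<^sub>F X in at_top. \<forall>W \<theta> s. bump_average (exp 6) X W \<longrightarrow>
          ((\<lambda>g. tuple_coeff l c g * tuple_phase l g \<theta> * W (tuple_inner l g \<rho>)) has_sum s) (tuples l \<eta>) \<longrightarrow>
          norm (s - ?m) \<le> D * exp (- (ln X powr (3 / 2)))" by blast
      have "\<forall>\<^sub>F N in sequentially. \<forall>\<theta>\<in>torus.
          norm (DMW l F \<rho> N \<theta> - ?m) \<le> D * exp (- (ln (real N) powr (3 / 2)))"
        using eventually_compose_filterlim[OF D filterlim_real_sequentially] eventually_ge_at_top[of 2]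
        by eventually_elim (use bump_average_discrete_mean sum_D in blast)
      then show ?thesis by blast
    qed
    moreover have "\<exists>C. \<forall>\<^sub>F T in at_top. \<forall>\<theta>\<in>torus.
        norm (CMW l F \<rho> T \<theta> - ?m) \<le> C * exp (- (ln T powr (3 / 2)))"
    proof -
      have "0 \<le> 1 / bump_mass" using bump_mass_pos by simp
      from error[OF this]
      obtain D where D: "\<forall>\<^sub>F X in at_top. \<forall>W \<theta> s. bump_average (1 / bump_mass) X W \<longrightarrow>
          ((\<lambda>g. tuple_coeff l c g * tuple_phase l g \<theta> * W (tuple_inner l g \<rho>)) has_sum s) (tuples l \<eta>) \<longrightarrow>
          norm (s - ?m) \<le> D * exp (- (ln X powr (3 / 2)))" by blast
      have "\<forall>\<^sub>F T in at_top. \<forall>\<theta>\<in>torus.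
          norm (CMW l F \<rho> T \<theta> - ?m) \<le> D * exp (- (ln T powr (3 / 2)))"
        using D eventually_gt_at_top[of 0]
        by eventually_elim (use bump_average_continuous_mean sum_C in blast)
      then show ?thesis by blast
    qed
    ultimately show "\<exists>\<zeta>\<^sub>3::real. \<zeta>\<^sub>3 > 1 \<and>
      (\<exists>C. \<forall>\<^sub>F N in sequentially. \<forall>\<theta>\<in>torus.
         norm (DMW l F \<rho> N \<theta> - ?m) \<le> C * exp (- (ln (real N) powr \<zeta>\<^sub>3))) \<and>
      (\<exists>C. \<forall>\<^sub>F T in at_top. \<forall>\<theta>\<in>torus.
         norm (CMW l F \<rho> T \<theta> - ?m) \<le> C * exp (- (ln T powr \<zeta>\<^sub>3)))"
      by (intro exI[of _ "3 / 2"]) simp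
  qed
qed

end
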